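(* Let $V$, $\mu$, $\Omega$, $S^2=L^2(\mu)^m$, $A$, $B$, $\mathcal D$, $K$, $H$ be as in the context, and for $\ell\in V^\star$ let $(\Sigma_\ell,u_\ell)\in K\times V$ be the unique pair with $$\langle A\Sigma_\ell+B^\star u_\ell,T-\Sigma_\ell\rangle-\langle B\Sigma_\ell-\ell,v-u_\ell\rangle\ge0\qquad\forall(T,v)\in K\times V.$$ Let $\ell_0\in V^\star$ be given, set $\Xi_{\ell_0}:=-A\Sigma_{\ell_0}-B^\star u_{\ell_0}$, and denote by $\lambda_0\in L^2(\mu)$, $\lambda_0\ge0$, the function that vanishes a.e. on $\{|\mathcal D\Sigma_{\ell_0}|_{\mathbb R^n}<1\}$ and satisfies $$A\Sigma_{\ell_0}+B^\star u_{\ell_0}+\lambda_0\,\mathcal D^\star\mathcal D\Sigma_{\ell_0}=0 .$$ Then the mapping $V^\star\ni\ell\mapsto(\Sigma_\ell,u_\ell)\in S^2\times V$ is strongly Hadamard directionally differentiable in $\ell_0$ (in every direction). Moreover, the directional derivative $(\Sigma',u')\in\mathcal K_{\delta_K}^{\Sigma_{\ell_0},\Xi_{\ell_0}}\times V$ in direction $\delta\ell\in V^\star$ is given by the unique solution of $$\langle A\Sigma'+B^\star u',T-\Sigma'\rangle+\int_\Omega\lambda_0\,(\mathcal D\Sigma',\mathcal D(T-\Sigma'))_{\mathbb R^n}\,\mathrm d\mu-\langle B\Sigma'-\delta\ell,v-u'\rangle\ge0\qquad\forall(T,v)\in\mathcal K_{\delta_K}^{\Sigma_{\ell_0},\Xi_{\ell_0}}\times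 V.$$
   Context: Setting: $V$ is a (real) Hilbert space, $\mu$ is a $\sigma$-finite measure on a set $\Omega$, $m,n\in\mathbb N$, and $S^2:=L^2(\mu)^m$ (identified with its dual where convenient). $A:S^2\to(S^2)^\star$ is bounded, linear, symmetric and coercive; $B:S^2\to V^\star$ is bounded and linear, with adjoint $B^\star:V\to(S^2)^\star$; $\mathcal D:\mathbb R^m\to\mathbb R^n$ is linear with transpose $\mathcal D^\star$, acting pointwise on $S^2$. $K:=\{\Sigma\in S^2:|\mathcal D\Sigma|_{\mathbb R^n}\le1\text{ a.e. in }\Omega\}$. It is assumed that the restriction of $B$ to $H:=\{\Sigma\in S^2:|\mathcal D\Sigma|_{\mathbb R^n}=0\text{ a.e. in }\Omega\}$ is surjective onto $V^\star$. Existence and uniqueness of $(\Sigma_\ell,u_\ell)$ hold for every $\ell\in V^\star$ in this setting, and the function $\lambda_0$ exists because $\Xi_{\ell_0}$ belongs to the normal cone of $K$ at $\Sigma_{\ell_0}$. $\delta_K$ is the indicator function of $K$ ($0$ on $K$, $+\infty$ elsewhere). For $\Sigma\in K$, $\Xi\in S^2$ its second subderivative is $$Q_{\delta_K}^{\Sigma,\Xi}(T):=\inf\Big\{\liminf_{k\to\infty}\frac{\delta_K(\Sigma+t_kT_k)-\delta_K(\Sigma)-t_k(\Xi,T_k)_{S^2}}{t_k^2/2}\ \Big|\ t_k\searrow0,\ T_k\rightharpoonup T\text{ in }S^2\Big\},$$ and $\mathcal K_{\delta_K}^{\Sigma,\Xi}:=\{T\in S^2:Q_{\delta_K}^{\Sigma,\Xi}(T)<\infty\}$.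 A map $s:V^\star\to W$ into a normed space is strongly Hadamard directionally differentiable in $\ell_0$ if for every $\delta\ell\in V^\star$ there is $s'\in W$ with $(s(\ell_0+t\,\delta\ell_t)-s(\ell_0))/t\to s'$ in $W$ as $t\searrow0$ for every family $\delta\ell_t\to\delta\ell$ in $V^\star$; $s'$ is the directional derivative in direction $\delta\ell$. *)

theory Defs
  imports "HOL-Analysis.Analysis"
begin

text \<open>
  The measure is a term, so the Lebesgue space is a set of representatives rather than a type:
  elements are square-integrable functions, identified when they agree almost everywhere.
  Operators on the space are functions of representatives whose values outside the space are
  irrelevant; boundedness forces them to respect almost-everywhere equality.
\<close>

definition L2 :: "'w measure \<Rightarrow> ('w \<Rightarrow> 'b::euclidean_space) set" where
  "L2 M = {f \<in> borel_measurable M. integrable M (\<lambda>x. (norm (f x))\<^sup>2)}"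

definition L2_inner :: "'w measure \<Rightarrow> ('w \<Rightarrow> 'b::euclidean_space) \<Rightarrow> ('w \<Rightarrow> 'b) \<Rightarrow> real" where
  "L2_inner M f g = (LINT x|M. f x \<bullet> g x)"

definition L2_norm :: "'w measure \<Rightarrow> ('w \<Rightarrow> 'b::euclidean_space) \<Rightarrow> real" where
  "L2_norm M f = sqrt (L2_inner M f f)"

definition L2_bounded_linear ::
  "'w measure \<Rightarrow> (('w \<Rightarrow> 'b::euclidean_space) \<Rightarrow> 'c::real_normed_vector) \<Rightarrow> bool" where
  "L2_bounded_linear M F \<longleftrightarrow>
     (\<forall>f\<in>L2 M. \<forall>g\<in>L2 M. F (\<lambda>x. f x + g x) = F f + F g) \<and>
     (\<forall>c. \<forall>f\<in>L2 M. F (\<lambda>x. c *\<^sub>R f x) = c *\<^sub>R F f) \<and>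
     (\<exists>C. \<forall>f\<in>L2 M. norm (F f) \<le> C * L2_norm M f)"

text \<open>
  A bounded linear map from the Lebesgue space into its topological dual is given in curried
  form: \<open>A f g\<close> is the duality pairing of the image of \<open>f\<close> with \<open>g\<close>.
\<close>

definition L2_dual_operator ::
  "'w measure \<Rightarrow> (('w \<Rightarrow> 'b::euclidean_space) \<Rightarrow> ('w \<Rightarrow> 'b) \<Rightarrow> real) \<Rightarrow> bool" where
  "L2_dual_operator M A \<longleftrightarrow>
     (\<forall>f\<in>L2 M. L2_bounded_linear M (A f)) \<and>
     (\<forall>f\<in>L2 M. \<forall>g\<in>L2 M. \<forall>h\<in>L2 M. A (\<lambda>x. f x + g x) h = A f h + A g h) \<and>
     (\<forall>c. \<forall>f\<in>L2 M. \<forall>h\<in>L2 M. A (\<lambda>x. c *\<^sub>R f x) h = c * A f h) \<and>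
     (\<exists>C. \<forall>f\<in>L2 M. \<forall>h\<in>L2 M. \<bar>A f h\<bar> \<le> C * L2_norm M f * L2_norm M h)"

definition L2_symmetric ::
  "'w measure \<Rightarrow> (('w \<Rightarrow> 'b::euclidean_space) \<Rightarrow> ('w \<Rightarrow> 'b) \<Rightarrow> real) \<Rightarrow> bool" where
  "L2_symmetric M A \<longleftrightarrow> (\<forall>f\<in>L2 M. \<forall>g\<in>L2 M. A f g = A g f)"

definition L2_coercive ::
  "'w measure \<Rightarrow> (('w \<Rightarrow> 'b::euclidean_space) \<Rightarrow> ('w \<Rightarrow> 'b) \<Rightarrow> real) \<Rightarrow> bool" where
  "L2_coercive M A \<longleftrightarrow> (\<exists>\<alpha>>0. \<forall>f\<in>L2 M. A f f \<ge> \<alpha> * (L2_norm M f)\<^sup>2)"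

definition L2_weakly_tendsto ::
  "'w measure \<Rightarrow> (nat \<Rightarrow> 'w \<Rightarrow> 'b::euclidean_space) \<Rightarrow> ('w \<Rightarrow> 'b) \<Rightarrow> bool" where
  "L2_weakly_tendsto M Tk T \<longleftrightarrow>
     (\<forall>k. Tk k \<in> L2 M) \<and> T \<in> L2 M \<and>
     (\<forall>F :: ('w \<Rightarrow> 'b) \<Rightarrow> real. L2_bounded_linear M F \<longrightarrow> (\<lambda>k. F (Tk k)) \<longlonglongrightarrow> F T)"

definition B_star ::
  "(('w \<Rightarrow> 'b::euclidean_space) \<Rightarrow> 'v::real_normed_vector \<Rightarrow>\<^sub>L real) \<Rightarrow> 'v \<Rightarrow> ('w \<Rightarrow> 'b) \<Rightarrow> real" where
  "B_star B v T = blinfun_apply (B T) v"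

definition K_set ::
  "'w measure \<Rightarrow> ('b::euclidean_space \<Rightarrow> 'd::euclidean_space) \<Rightarrow> ('w \<Rightarrow> 'b) set" where
  "K_set M D = {S \<in> L2 M. AE x in M. norm (D (S x)) \<le> 1}"

definition H_set ::
  "'w measure \<Rightarrow> ('b::euclidean_space \<Rightarrow> 'd::euclidean_space) \<Rightarrow> ('w \<Rightarrow> 'b) set" where
  "H_set M D = {S \<in> L2 M. AE x in M. norm (D (S x)) = 0}"

definition indicator_fun :: "'a set \<Rightarrow> 'a \<Rightarrow> ereal" where
  "indicator_fun K x = (if x \<in> K then 0 else \<infinity>)"

definition second_subderivative ::
  "'w measure \<Rightarrow> (('w \<Rightarrow> 'b::euclidean_space) \<Rightarrow> ereal) \<Rightarrow> ('w \<Rightarrow> 'b) \<Rightarrow> ('w \<Rightarrow> 'b) \<Rightarrow> ('w \<Rightarrow> 'b) \<Rightarrow> ereal" where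
  "second_subderivative M j S Xi T =
     Inf {liminf (\<lambda>k. (j (\<lambda>x. S x + t k *\<^sub>R Tk k x) - j S - ereal (t k * L2_inner M Xi (Tk k)))
                      / ereal ((t k)\<^sup>2 / 2)) | t Tk.
            (\<forall>k. t k > 0) \<and> t \<longlonglongrightarrow> 0 \<and> L2_weakly_tendsto M Tk T}"

definition reduced_critical_cone ::
  "'w measure \<Rightarrow> (('w \<Rightarrow> 'b::euclidean_space) \<Rightarrow> ereal) \<Rightarrow> ('w \<Rightarrow> 'b) \<Rightarrow> ('w \<Rightarrow> 'b) \<Rightarrow> ('w \<Rightarrow> 'b) set" where
  "reduced_critical_cone M j S Xi = {T \<in> L2 M. second_subderivative M j S Xi T < \<infinity>}"

definition solves_VI ::
  "'w measure \<Rightarrow> (('w \<Rightarrow> 'b::euclidean_space) \<Rightarrow> ('w \<Rightarrow> 'b) \<Rightarrow> real)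
   \<Rightarrow> (('w \<Rightarrow> 'b) \<Rightarrow> 'v::real_normed_vector \<Rightarrow>\<^sub>L real) \<Rightarrow> ('b \<Rightarrow> 'd::euclidean_space)
   \<Rightarrow> ('v \<Rightarrow>\<^sub>L real) \<Rightarrow> ('w \<Rightarrow> 'b) \<times> 'v \<Rightarrow> bool" where
  "solves_VI M A B D l = (\<lambda>(S, u). S \<in> K_set M D \<and>
     (\<forall>T\<in>K_set M D. \<forall>v.
        A S (\<lambda>x. T x - S x) + B_star B u (\<lambda>x. T x - S x)
        - blinfun_apply (B S - l) (v - u) \<ge> 0))"

text \<open>
  The linearized variational inequality over a set \<open>C\<close>. In the intended use, with \<open>C\<close> the
  domain of the second subderivative, the weighted integrand is integrable for all members of
  \<open>C\<close>, so the totalized value of the Lebesgue integral plays no role.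
\<close>

definition solves_linearized_VI ::
  "'w measure \<Rightarrow> (('w \<Rightarrow> 'b::euclidean_space) \<Rightarrow> ('w \<Rightarrow> 'b) \<Rightarrow> real)
   \<Rightarrow> (('w \<Rightarrow> 'b) \<Rightarrow> 'v::real_normed_vector \<Rightarrow>\<^sub>L real) \<Rightarrow> ('b \<Rightarrow> 'd::euclidean_space)
   \<Rightarrow> ('w \<Rightarrow> real) \<Rightarrow> ('w \<Rightarrow> 'b) set \<Rightarrow> ('v \<Rightarrow>\<^sub>L real) \<Rightarrow> ('w \<Rightarrow> 'b) \<times> 'v \<Rightarrow> bool" where
  "solves_linearized_VI M A B D lam C dl = (\<lambda>(S, u). S \<in> C \<and>
     (\<forall>T\<in>C. \<forall>v.
        A S (\<lambda>x. T x - S x) + B_star B u (\<lambda>x. T x - S x)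
        + (LINT x|M. lam x * (D (S x) \<bullet> D (T x - S x)))
        - blinfun_apply (B S - dl) (v - u) \<ge> 0))"

text \<open>
  Strong Hadamard differentiability for maps into the product of the Lebesgue space with \<open>'v\<close>;
  convergence in the product norm is convergence of both components. The perturbed directions
  form an arbitrary family indexed by the step size.
\<close>

definition has_strong_hadamard_derivative ::
  "'w measure \<Rightarrow> ('e::real_normed_vector \<Rightarrow> ('w \<Rightarrow> 'b::euclidean_space) \<times> 'v::real_normed_vector)
   \<Rightarrow> 'e \<Rightarrow> 'e \<Rightarrow> ('w \<Rightarrow> 'b) \<times> 'v \<Rightarrow> bool" where
  "has_strong_hadamard_derivative M s l0 dl s' \<longleftrightarrow> fst s' \<in> L2 M \<and>
     (\<forall>d :: real \<Rightarrow> 'e. (d \<longlongrightarrow> dl) (at_right 0) \<longrightarrow>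
        ((\<lambda>t. L2_norm M (\<lambda>x. (fst (s (l0 + t *\<^sub>R d t)) x - fst (s l0) x) /\<^sub>R t - fst s' x))
           \<longlongrightarrow> 0) (at_right 0) \<and>
        ((\<lambda>t. (snd (s (l0 + t *\<^sub>R d t)) - snd (s l0)) /\<^sub>R t) \<longlongrightarrow> snd s') (at_right 0))"

definition strongly_hadamard_differentiable ::
  "'w measure \<Rightarrow> ('e::real_normed_vector \<Rightarrow> ('w \<Rightarrow> 'b::euclidean_space) \<times> 'v::real_normed_vector)
   \<Rightarrow> 'e \<Rightarrow> bool" where
  "strongly_hadamard_differentiable M s l0 \<longleftrightarrow>
     (\<forall>dl. \<exists>s'. has_strong_hadamard_derivative M s l0 dl s')"

end

(*
  The proof avoids weak compactness.  Surjectivity of B on H gives an inf-sup estimate, hence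
  Lipschitz continuity of the solution map; so it suffices to treat the difference quotients in a
  fixed direction.  They lie in shrinking convex cones around the critical cone and, by comparison
  with a recovery sequence, their energy A T T + (integral of lam0 |D T|^2) is asymptotically
  minimal there, so the uniform convexity of the energy makes them converge strongly.  Passing to
  the limit in the scaled inequalities yields an energy inequality on the critical cone, whose
  first variation is the linearised variational inequality.
*)
theory Submission imports Defs begin

text \<open>The obstacle is that \<open>lam0\<close> and \<open>D T\<close> are only
  square-integrable, so the integral of \<open>lam0 * (norm (D T))^2\<close> may diverge and the
  second-order form is not a bounded form on the whole space. It lives on \<open>Wt\<close>, and
  membership in \<open>Wt\<close> has to be produced, not assumed. Its source is feasibility:
  squaring \<open>norm (D (S0 + t T)) <= 1\<close> where \<open>norm (D S0) = 1\<close> and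
  weighting by \<open>lam0\<close> shows that the pairing of \<open>Xi0\<close> with
  \<open>T\<close> is at most \<open>- (t / 2) * q T\<close>. A lower bound of order
  \<open>t\<close> on that pairing thus yields approximate criticality and bounded curvature at
  once; this is where the slack \<open>t / 2 * c\<close> of the cones comes from. In the other
  direction, correcting \<open>S0 + t R\<close> to a feasible point costs at most
  \<open>t / 2 * q R\<close> in the same pairing, so the two bounds meet. The multiplier drops out
  of the minimisation because every difference quotient has the image \<open>dl\<close> under
  \<open>B\<close>.\<close>

section \<open>Two analytic tools: Fatou's lemma and uniform boundedness\<close>

lemma Fatou_integrable:
  fixes g :: "nat \<Rightarrow> 'a \<Rightarrow> real"
  assumes int: "\<And>n. integrable M (g n)" and nn: "\<And>n. AE x in M. 0 \<le> g n x"
    and lim: "AE x in M. (\<lambda>n. g n x) \<longlonglongrightarrow> h x" and meas: "h \<in> borel_measurable M"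
    and le: "\<And>n. integral\<^sup>L M (g n) \<le> c"
  shows "integrable M h" and "integral\<^sup>L M h \<le> c"
proof -
  \<comment> \<open>\<open>ennreal\<close> sends negative numbers to zero, so the bound on the
    nonnegative integral can be read back as a real bound only for \<open>0 <= c\<close>.\<close>
  have c0: "0 \<le> c"
    using integral_nonneg_AE[OF nn[of 0]] le[of 0] by linarith
  have nnall: "AE x in M. \<forall>n. 0 \<le> g n x"
    using nn by (simp add: AE_all_countable)
  have h0: "AE x in M. 0 \<le> h x"
    using nnall lim
  proof eventually_elim
    case (elim x)
    then show ?case by (intro LIMSEQ_le_const[OF elim(2)]) auto
  qed
  have "(\<integral>\<^sup>+x. ennreal (h x) \<partial>M) = (\<integral>\<^sup>+x. liminf (\<lambda>n. ennreal (g n x)) \<partial>M)"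
  proof (rule nn_integral_cong_AE)
    show "AE x in M. ennreal (h x) = liminf (\<lambda>n. ennreal (g n x))"
      using lim
    proof eventually_elim
      case (elim x)
      have "(\<lambda>n. ennreal (g n x)) \<longlonglongrightarrow> ennreal (h x)"
        using elim by (rule tendsto_ennrealI)
      then show ?case by (metis lim_imp_Liminf sequentially_bot)
    qed
  qed
  also have "\<dots> \<le> liminf (\<lambda>n. \<integral>\<^sup>+x. ennreal (g n x) \<partial>M)"
    by (rule nn_integral_liminf) (use int in auto)
  also have "\<dots> \<le> liminf (\<lambda>n::nat. ennreal c)"
    by (intro Liminf_mono always_eventually allI)
       (use nn_integral_eq_integral[OF int nn] le in \<open>auto intro: ennreal_leI\<close>)
  also have "\<dots> = ennreal c"
    by (simp add: Liminf_const)
  finally have *: "(\<integral>\<^sup>+x. ennreal (h x) \<partial>M) \<le> ennreal c" .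
  then have "(\<integral>\<^sup>+x. ennreal (h x) \<partial>M) < \<infinity>"
    by (rule order.strict_trans1) simp
  with meas h0 show i: "integrable M h"
    by (intro integrableI_nonneg) auto
  show "integral\<^sup>L M h \<le> c"
    using * nn_integral_eq_integral[OF i h0] c0 by simp
qed

text \<open>Banach-Steinhaus for the functionals given by \<open>S\<close>: the closed sets
  \<open>E n\<close> cover the space, so by Baire's theorem one of them contains a ball, whose
  radius controls all of \<open>S\<close>.\<close>

lemma uniform_boundedness_hilbert:
  fixes S :: "'v::{real_inner, complete_space} set"
  assumes "\<And>y. \<exists>c. \<forall>v\<in>S. \<bar>y \<bullet> v\<bar> \<le> c"
  shows "\<exists>C>0. \<forall>v\<in>S. norm v \<le> C"
proof -
  define E where "E n = {y. \<forall>v\<in>S. \<bar>y \<bullet> v\<bar> \<le> real n}" for n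
  have closedE: "closed (E n)" for n
  proof -
    have "E n = (\<Inter>v\<in>S. {y. \<bar>y \<bullet> v\<bar> \<le> real n})" by (auto simp: E_def)
    then show ?thesis by (auto intro!: closed_INT closed_Collect_le continuous_intros)
  qed
  have cover: "(\<Union>n. E n) = UNIV"
  proof (intro set_eqI iffI UNIV_I)
    fix y
    obtain c where c: "\<forall>v\<in>S. \<bar>y \<bullet> v\<bar> \<le> c" using assms by blast
    obtain n where "c \<le> real n" using real_arch_simple by blast
    with c have "y \<in> E n" by (force simp: E_def)
    then show "y \<in> (\<Union>n. E n)" by blast
  qed
  have "\<exists>n. interior (E n) \<noteq> {}"
  proof (rule ccontr)
    assume "\<not> ?thesis"
    then have "euclidean interior_of (\<Union>(range E)) = {}"
      by (intro Baire_category_alt disjI1 completely_metrizable_space_euclidean)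
         (auto simp: closedE)
    with cover show False by simp
  qed
  then obtain n y where "y \<in> interior (E n)" by blast
  then obtain r where r: "r > 0" "cball y r \<subseteq> E n"
    by (auto simp: mem_interior_cball)
  have "norm v \<le> 2 * real n / r" if v: "v \<in> S" for v
  proof (cases "v = 0")
    case True
    with r show ?thesis by simp
  next
    case False
    \<comment> \<open>Moving from the centre by \<open>r\<close> along \<open>v\<close> changes the
      product with \<open>v\<close> by exactly \<open>r * norm v\<close>, while both end points lie
      in \<open>E n\<close>; hence the factor 2.\<close>
    let ?z = "y + (r / norm v) *\<^sub>R v"
    have "?z \<in> cball y r" "y \<in> cball y r" using False r by (auto simp: dist_norm)
    then have "?z \<in> E n" "y \<in> E n"
      using r(2) by blast+
    then have "\<bar>?z \<bullet> v\<bar> \<le> real n" "\<bar>y \<bullet> v\<bar> \<le> real n"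
      using v by (auto simp: E_def)
    moreover have "?z \<bullet> v = y \<bullet> v + r * norm v"
      using False by (simp add: inner_add_left dot_square_norm power2_eq_square)
    ultimately have "r * norm v \<le> 2 * real n" by linarith
    then show ?thesis using r by (simp add: field_simps)
  qed
  then have "\<forall>v\<in>S. norm v \<le> 2 * real n / r + 1" by fastforce
  moreover have "2 * real n / r + 1 > 0" using r by (simp add: add_nonneg_pos)
  ultimately show ?thesis by blast
qed

subsection \<open>The space of square-integrable functions\<close>

lemma L2_measurable [measurable_dest]: "f \<in> L2 M \<Longrightarrow> f \<in> borel_measurable M"
  by (simp add: L2_def)

lemma L2_integrable_power2: "f \<in> L2 M \<Longrightarrow> integrable M (\<lambda>x. (norm (f x))\<^sup>2)"
  by (simp add: L2_def)

lemma L2_zero [simp]: "(\<lambda>x. 0) \<in> L2 M"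
  by (simp add: L2_def)

lemma L2_bound:
  assumes "f \<in> L2 M" "g \<in> borel_measurable M" "AE x in M. norm (g x) \<le> c * norm (f x)"
  shows "g \<in> L2 M"
proof -
  have "integrable M (\<lambda>x. (norm (g x))\<^sup>2)"
  proof (rule Bochner_Integration.integrable_bound)
    show "integrable M (\<lambda>x. c\<^sup>2 * (norm (f x))\<^sup>2)"
      using L2_integrable_power2[OF assms(1)] by simp
    show "(\<lambda>x. (norm (g x))\<^sup>2) \<in> borel_measurable M" using assms(2) by measurable
    show "AE x in M. norm ((norm (g x))\<^sup>2) \<le> norm (c\<^sup>2 * (norm (f x))\<^sup>2)"
      using assms(3)
    proof eventually_elim
      case (elim x)
      from power_mono[OF this, of 2] show ?case by (simp add: power_mult_distrib)
    qed
  qed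
  with assms(2) show ?thesis by (simp add: L2_def)
qed

lemma L2_add [intro]:
  assumes "f \<in> L2 M" "g \<in> L2 M"
  shows "(\<lambda>x. f x + g x) \<in> L2 M"
proof -
  have [measurable]: "f \<in> borel_measurable M" "g \<in> borel_measurable M"
    using assms by (auto dest: L2_measurable)
  have "integrable M (\<lambda>x. (norm (f x + g x))\<^sup>2)"
  proof (rule Bochner_Integration.integrable_bound)
    show "integrable M (\<lambda>x. 2 * (norm (f x))\<^sup>2 + 2 * (norm (g x))\<^sup>2)"
      using assms by (auto intro!: L2_integrable_power2)
    show "AE x in M. norm ((norm (f x + g x))\<^sup>2) \<le> norm (2 * (norm (f x))\<^sup>2 + 2 * (norm (g x))\<^sup>2)"
    proof (rule AE_I2)
      fix x
      have "(norm (f x + g x))\<^sup>2 \<le> (norm (f x) + norm (g x))\<^sup>2"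
        by (simp add: norm_triangle_ineq power_mono)
      also have "\<dots> \<le> 2 * (norm (f x))\<^sup>2 + 2 * (norm (g x))\<^sup>2"
        using sum_squares_bound[of "norm (f x)" "norm (g x)"] by (simp add: power2_sum)
      finally show "norm ((norm (f x + g x))\<^sup>2) \<le> norm (2 * (norm (f x))\<^sup>2 + 2 * (norm (g x))\<^sup>2)"
        by simp
    qed
  qed measurable
  then show ?thesis by (simp add: L2_def)
qed

lemma L2_scaleR [intro]: "f \<in> L2 M \<Longrightarrow> (\<lambda>x. c *\<^sub>R f x) \<in> L2 M"
  by (rule L2_bound[of f M _ "\<bar>c\<bar>"]) (auto dest: L2_measurable)

lemma L2_uminus [intro]: "f \<in> L2 M \<Longrightarrow> (\<lambda>x. - f x) \<in> L2 M"
  using L2_scaleR[of f M "-1"] by simp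

lemma L2_diff [intro]: "f \<in> L2 M \<Longrightarrow> g \<in> L2 M \<Longrightarrow> (\<lambda>x. f x - g x) \<in> L2 M"
  using L2_add[of f M "\<lambda>x. - g x"] by auto

lemma L2_linear_image [intro]:
  fixes D :: "'b::euclidean_space \<Rightarrow> 'd::euclidean_space"
  assumes "linear D" "f \<in> L2 M"
  shows "(\<lambda>x. D (f x)) \<in> L2 M"
proof -
  have "bounded_linear D" using assms(1) by (simp add: linear_conv_bounded_linear)
  then obtain c where c: "\<And>y. norm (D y) \<le> norm y * c"
    using bounded_linear.bounded by blast
  have "D \<in> borel_measurable borel"
    using \<open>bounded_linear D\<close>
    by (intro borel_measurable_continuous_onI linear_continuous_on)
  then have "(\<lambda>x. D (f x)) \<in> borel_measurable M"
    using L2_measurable[OF assms(2)] by measurable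
  then show ?thesis
    by (rule L2_bound[OF assms(2), of _ c]) (use c in \<open>auto simp: mult.commute\<close>)
qed

lemma L2_integrable_inner:
  assumes "f \<in> L2 M" "g \<in> L2 M"
  shows "integrable M (\<lambda>x. f x \<bullet> g x)"
proof (rule Bochner_Integration.integrable_bound)
  have [measurable]: "f \<in> borel_measurable M" "g \<in> borel_measurable M"
    using assms by (auto dest: L2_measurable)
  show "integrable M (\<lambda>x. (norm (f x))\<^sup>2 + (norm (g x))\<^sup>2)"
    using assms by (auto intro!: L2_integrable_power2)
  show "(\<lambda>x. f x \<bullet> g x) \<in> borel_measurable M" by measurable
  show "AE x in M. norm (f x \<bullet> g x) \<le> norm ((norm (f x))\<^sup>2 + (norm (g x))\<^sup>2)"
  proof (rule AE_I2)
    fix x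
    have "\<bar>f x \<bullet> g x\<bar> \<le> norm (f x) * norm (g x)" by (rule Cauchy_Schwarz_ineq2)
    also have "2 * \<dots> \<le> (norm (f x))\<^sup>2 + (norm (g x))\<^sup>2"
      using sum_squares_bound[of "norm (f x)" "norm (g x)"] by (simp add: mult.assoc)
    finally show "norm (f x \<bullet> g x) \<le> norm ((norm (f x))\<^sup>2 + (norm (g x))\<^sup>2)"
      using Cauchy_Schwarz_ineq2[of "f x" "g x"] by (simp add: abs_if split: if_splits)
  qed
qed

lemma L2_inner_add_right:
  assumes "f \<in> L2 M" "g \<in> L2 M" "h \<in> L2 M"
  shows "L2_inner M h (\<lambda>x. f x + g x) = L2_inner M h f + L2_inner M h g"
  using assms by (simp add: L2_inner_def inner_add_right L2_integrable_inner)

lemma L2_inner_diff_right: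
  assumes "f \<in> L2 M" "g \<in> L2 M" "h \<in> L2 M"
  shows "L2_inner M h (\<lambda>x. f x - g x) = L2_inner M h f - L2_inner M h g"
  using assms by (simp add: L2_inner_def inner_diff_right L2_integrable_inner)

lemma L2_inner_scaleR_right: "L2_inner M h (\<lambda>x. c *\<^sub>R f x) = c * L2_inner M h f"
  by (simp add: L2_inner_def)

lemma L2_norm_power2: "(L2_norm M f)\<^sup>2 = (LINT x|M. (norm (f x))\<^sup>2)"
  by (simp add: L2_norm_def L2_inner_def power2_norm_eq_inner)

lemma L2_norm_nonneg [simp]: "0 \<le> L2_norm M f"
  by (simp add: L2_norm_def L2_inner_def)

text \<open>A quadratic form with two free coefficients replaces the usual normalisation of
  \<open>g\<close>, which is impossible when \<open>L2_norm M g\<close> vanishes.\<close>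

lemma L2_Cauchy_Schwarz:
  assumes "f \<in> L2 M" "g \<in> L2 M"
  shows "\<bar>L2_inner M f g\<bar> \<le> L2_norm M f * L2_norm M g"
proof -
  have fg: "integrable M (\<lambda>x. f x \<bullet> g x)" and ff: "integrable M (\<lambda>x. f x \<bullet> f x)"
    and gg: "integrable M (\<lambda>x. g x \<bullet> g x)"
    using assms by (auto intro: L2_integrable_inner)
  have quad: "0 \<le> s\<^sup>2 * (L2_norm M f)\<^sup>2 - 2 * s * r * L2_inner M f g + r\<^sup>2 * (L2_norm M g)\<^sup>2" for s r
  proof -
    have "0 \<le> (LINT x|M. (s *\<^sub>R f x - r *\<^sub>R g x) \<bullet> (s *\<^sub>R f x - r *\<^sub>R g x))"
      by (rule integral_nonneg_AE) simp
    also have "\<dots> = (LINT x|M. s\<^sup>2 * (f x \<bullet> f x) - 2 * s * r * (f x \<bullet> g x) + r\<^sup>2 * (g x \<bullet> g x))"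
      by (rule Bochner_Integration.integral_cong)
         (auto simp: inner_diff_left inner_diff_right power2_eq_square inner_commute algebra_simps)
    also have "\<dots> = s\<^sup>2 * (L2_norm M f)\<^sup>2 - 2 * s * r * L2_inner M f g + r\<^sup>2 * (L2_norm M g)\<^sup>2"
      using fg ff gg by (simp add: L2_norm_power2 L2_inner_def power2_norm_eq_inner)
    finally show ?thesis .
  qed
  let ?a = "L2_norm M f" and ?b = "L2_norm M g" and ?c = "L2_inner M f g"
  have "?c\<^sup>2 \<le> ?a\<^sup>2 * ?b\<^sup>2"
  proof (cases "?b = 0")
    case False
    from quad[of "?b\<^sup>2" "?c"] have "0 \<le> ?b\<^sup>2 * (?a\<^sup>2 * ?b\<^sup>2 - ?c\<^sup>2)"
      by (simp add: algebra_simps power2_eq_square)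
    moreover have "0 < ?b\<^sup>2" using False by simp
    ultimately show ?thesis by (simp add: zero_le_mult_iff)
  next
    case True
    show ?thesis
    proof (cases "?c = 0")
      case False
      \<comment> \<open>With \<open>?b = 0\<close> the form is affine in \<open>r\<close>, and this
        \<open>r\<close> makes the linear term exceed the constant one.\<close>
      from quad[of 1 "(?a\<^sup>2 + 1) / (2 * ?c)"] True False have "0 \<le> ?a\<^sup>2 - (?a\<^sup>2 + 1)"
        by simp
      then show ?thesis by simp
    qed simp
  qed
  then have "\<bar>?c\<bar>\<^sup>2 \<le> (?a * ?b)\<^sup>2" by (simp add: power_mult_distrib)
  then show ?thesis by (rule power2_le_imp_le) simp
qed

lemma L2_norm_triangle:
  assumes "f \<in> L2 M" "g \<in> L2 M"
  shows "L2_norm M (\<lambda>x. f x + g x) \<le> L2_norm M f + L2_norm M g"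
proof (rule power2_le_imp_le)
  have "(L2_norm M (\<lambda>x. f x + g x))\<^sup>2
      = (LINT x|M. f x \<bullet> f x + 2 * (f x \<bullet> g x) + g x \<bullet> g x)"
    by (simp add: L2_norm_power2 power2_norm_eq_inner inner_add_left inner_add_right
        inner_commute algebra_simps)
  also have "\<dots> = (L2_norm M f)\<^sup>2 + 2 * L2_inner M f g + (L2_norm M g)\<^sup>2"
    using assms by (simp add: L2_norm_power2 L2_inner_def power2_norm_eq_inner L2_integrable_inner)
  also have "\<dots> \<le> (L2_norm M f + L2_norm M g)\<^sup>2"
    using L2_Cauchy_Schwarz[OF assms] by (simp add: power2_sum)
  finally show "(L2_norm M (\<lambda>x. f x + g x))\<^sup>2 \<le> (L2_norm M f + L2_norm M g)\<^sup>2" .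
qed simp

lemma L2_norm_scaleR: "L2_norm M (\<lambda>x. c *\<^sub>R f x) = \<bar>c\<bar> * L2_norm M f"
  by (simp add: L2_norm_def L2_inner_def real_sqrt_mult flip: power2_eq_square mult.assoc)

lemma L2_norm_minus_commute: "L2_norm M (\<lambda>x. f x - g x) = L2_norm M (\<lambda>x. g x - f x)"
  by (simp add: L2_norm_def L2_inner_def inner_diff_left inner_diff_right inner_commute algebra_simps)

lemma L2_norm_triangle_diff:
  assumes "f \<in> L2 M" "g \<in> L2 M" "h \<in> L2 M"
  shows "L2_norm M (\<lambda>x. f x - g x) \<le> L2_norm M (\<lambda>x. f x - h x) + L2_norm M (\<lambda>x. h x - g x)"
  using L2_norm_triangle[of "\<lambda>x. f x - h x" M "\<lambda>x. h x - g x"] assms by auto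

lemma L2_norm_triangle_sub:
  assumes "f \<in> L2 M" "g \<in> L2 M"
  shows "L2_norm M f \<le> L2_norm M g + L2_norm M (\<lambda>x. f x - g x)"
  using L2_norm_triangle[of g M "\<lambda>x. f x - g x"] assms by auto

lemma L2_norm_eq_0_imp_AE:
  assumes "f \<in> L2 M" "L2_norm M f = 0"
  shows "AE x in M. f x = 0"
proof -
  have "(LINT x|M. (norm (f x))\<^sup>2) = 0"
    using assms(2) L2_norm_power2[of M f] by simp
  then have "AE x in M. (norm (f x))\<^sup>2 = 0"
    using integral_nonneg_eq_0_iff_AE[OF L2_integrable_power2[OF assms(1)]] by simp
  then show ?thesis by simp
qed

text \<open>Riesz-Fischer: a rapidly Cauchy subsequence converges almost everywhere, and Fatou's
  lemma makes its pointwise limit a limit in norm. The measure may be infinite, so square-integrable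
  differences need not be integrable and the squares themselves must give pointwise
  convergence.\<close>

lemma L2_complete:
  fixes f :: "nat \<Rightarrow> 'w \<Rightarrow> 'b::euclidean_space"
  assumes f: "\<And>n. f n \<in> L2 M"
    and cauchy: "\<And>e. e > 0 \<Longrightarrow> \<exists>N. \<forall>m\<ge>N. \<forall>n\<ge>N. L2_norm M (\<lambda>x. f m x - f n x) < e"
  shows "\<exists>g\<in>L2 M. (\<lambda>n. L2_norm M (\<lambda>x. f n x - g x)) \<longlonglongrightarrow> 0"
proof -
  have [measurable]: "f n \<in> borel_measurable M" for n using f by (rule L2_measurable)
  have "\<exists>N. \<forall>m\<ge>N. \<forall>n\<ge>N. L2_norm M (\<lambda>x. f m x - f n x) < (1/2)^k" for k
    by (rule cauchy) simp
  then obtain N where N: "\<And>k m n. m \<ge> N k \<Longrightarrow> n \<ge> N k \<Longrightarrow> L2_norm M (\<lambda>x. f m x - f n x) < (1/2)^k"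
    by metis
  define r where "r k = (\<Sum>i\<le>k. N i) + k" for k
  have rN: "r k \<ge> N k" for k
    unfolding r_def by (simp add: member_le_sum trans_le_add1)
  have rmono: "r k \<le> r (Suc k)" for k unfolding r_def by simp
  have rid: "r k \<ge> k" for k unfolding r_def by simp
  define d where "d k x = f (r (Suc k)) x - f (r k) x" for k x
  have dL2: "d k \<in> L2 M" for k unfolding d_def using f by auto
  have [measurable]: "d k \<in> borel_measurable M" for k using dL2 by (rule L2_measurable)
  have dn: "(LINT x|M. (norm (d k x))\<^sup>2) \<le> (1/4)^k" for k
  proof -
    have "L2_norm M (d k) < (1/2)^k"
      unfolding d_def by (rule N) (use rN rmono order_trans in blast)+
    then have "(L2_norm M (d k))\<^sup>2 \<le> ((1/2)^k)\<^sup>2" by (intro power_mono) auto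
    also have "\<dots> = (1/4::real)^k" by (simp add: power2_eq_square flip: power_mult_distrib)
    finally show ?thesis by (simp add: L2_norm_power2)
  qed
  \<comment> \<open>The weight \<open>2^k\<close> meets two demands: the integrals of the squares
    decay like \<open>(1/4)^k\<close>, so the weighted sum stays finite, and the weighted squares
    dominate \<open>norm (d k x)\<close> up to the summable term \<open>(1/2)^k\<close>.\<close>
  have "(\<integral>\<^sup>+x. (\<Sum>k. ennreal (2^k * (norm (d k x))\<^sup>2)) \<partial>M)
      = (\<Sum>k. \<integral>\<^sup>+x. ennreal (2^k * (norm (d k x))\<^sup>2) \<partial>M)"
    by (rule nn_integral_suminf) measurable
  also have "\<dots> \<le> (\<Sum>k. ennreal ((1/2)^k))"
  proof (rule suminf_le)
    fix k
    have "(\<integral>\<^sup>+x. ennreal (2^k * (norm (d k x))\<^sup>2) \<partial>M) = ennreal (LINT x|M. 2^k * (norm (d k x))\<^sup>2)"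
      by (rule nn_integral_eq_integral) (use L2_integrable_power2[OF dL2] in auto)
    also have "\<dots> \<le> ennreal (2^k * (1/4)^k)" using dn by (intro ennreal_leI) auto
    also have "2^k * (1/4)^k = (1/2::real)^k" by (simp flip: power_mult_distrib)
    finally show "(\<integral>\<^sup>+x. ennreal (2^k * (norm (d k x))\<^sup>2) \<partial>M) \<le> ennreal ((1/2)^k)" .
  qed auto
  also have "\<dots> = ennreal (\<Sum>k. (1/2)^k)"
    by (rule suminf_ennreal2) (auto intro: summable_geometric)
  also have "\<dots> < \<infinity>" by simp
  finally have "AE x in M. (\<Sum>k. ennreal (2^k * (norm (d k x))\<^sup>2)) \<noteq> \<infinity>"
    by (intro nn_integral_PInf_AE) auto
  then have conv: "AE x in M. convergent (\<lambda>k. f (r k) x)"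
  proof eventually_elim
    case (elim x)
    have s1: "summable (\<lambda>k. 2^k * (norm (d k x))\<^sup>2)"
      using elim by (intro summable_suminf_not_top) auto
    have "summable (\<lambda>k. d k x)"
    proof (rule summable_norm_cancel, rule summable_comparison_test')
      show "summable (\<lambda>k. 2^k * (norm (d k x))\<^sup>2 + (1/2)^k)"
        by (intro summable_add s1) (auto intro: summable_geometric)
      fix k :: nat
      have "2 * norm (d k x) \<le> 2^k * (norm (d k x))\<^sup>2 + (1/2)^k"
      proof -
        have "0 \<le> (2^k * norm (d k x) - 1)\<^sup>2 * (1/2)^k" by simp
        also have "\<dots> = (2^k * (1/2)^k) * (2^k * (norm (d k x))\<^sup>2) - 2 * (2^k * (1/2)^k) * norm (d k x) + (1/2::real)^k"
          by (simp add: power2_eq_square algebra_simps)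
        also have "2^k * (1/2)^k = (1::real)" by (simp flip: power_mult_distrib)
        finally show ?thesis by simp
      qed
      then show "norm (norm (d k x)) \<le> 2^k * (norm (d k x))\<^sup>2 + (1/2)^k"
        unfolding real_norm_def abs_norm_cancel using norm_ge_zero[of "d k x"] by linarith
    qed
    then have "convergent (\<lambda>n. \<Sum>k<n. d k x)" by (simp add: summable_iff_convergent)
    moreover have "(\<Sum>k<n. d k x) = f (r n) x - f (r 0) x" for n
      unfolding d_def by (rule sum_lessThan_telescope)
    ultimately have "convergent (\<lambda>n. (f (r n) x - f (r 0) x) + f (r 0) x)"
      by (intro convergent_add convergent_const) simp
    then show ?case by simp
  qed
  define g where "g x = lim (\<lambda>k. f (r k) x)" for x
  have [measurable]: "g \<in> borel_measurable M" unfolding g_def by measurable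
  have lim: "AE x in M. (\<lambda>k. f (r k) x) \<longlonglongrightarrow> g x"
    using conv by eventually_elim (simp add: g_def convergent_LIMSEQ_iff)
  \<comment> \<open>One index is fixed while the other runs to infinity along the subsequence;
    Fatou's lemma preserves the Cauchy bound.\<close>
  have tail: "integrable M (\<lambda>x. (norm (f n x - g x))\<^sup>2) \<and> L2_norm M (\<lambda>x. f n x - g x) \<le> (1/2)^k"
    if n: "n \<ge> N k" for n k
  proof -
    have lim': "AE x in M. (\<lambda>j. (norm (f n x - f (r (j + k)) x))\<^sup>2) \<longlonglongrightarrow> (norm (f n x - g x))\<^sup>2"
      using lim
    proof eventually_elim
      case (elim x)
      then have "(\<lambda>j. f (r (j + k)) x) \<longlonglongrightarrow> g x" by (rule LIMSEQ_ignore_initial_segment)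
      then show ?case by (intro tendsto_intros)
    qed
    have int: "integrable M (\<lambda>x. (norm (f n x - f (r (j + k)) x))\<^sup>2)" for j
      using f by (intro L2_integrable_power2) auto
    have le: "(LINT x|M. (norm (f n x - f (r (j + k)) x))\<^sup>2) \<le> ((1/2)^k)\<^sup>2" for j
    proof -
      have "r k \<le> r (j + k)" by (induction j) (auto intro: order_trans rmono)
      then have "L2_norm M (\<lambda>x. f n x - f (r (j + k)) x) < (1/2)^k"
        by (intro N) (use n rN order_trans in blast)+
      then have "(L2_norm M (\<lambda>x. f n x - f (r (j + k)) x))\<^sup>2 \<le> ((1/2)^k)\<^sup>2"
        by (intro power_mono) auto
      then show ?thesis by (simp add: L2_norm_power2)
    qed
    note F = Fatou_integrable[of M "\<lambda>j x. (norm (f n x - f (r (j + k)) x))\<^sup>2", OF int _ lim' _ le]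
    have "(L2_norm M (\<lambda>x. f n x - g x))\<^sup>2 \<le> ((1/2)^k)\<^sup>2"
      unfolding L2_norm_power2 by (rule F(2)) auto
    then have "L2_norm M (\<lambda>x. f n x - g x) \<le> (1/2)^k" by (rule power2_le_imp_le) simp
    moreover have "integrable M (\<lambda>x. (norm (f n x - g x))\<^sup>2)" by (rule F(1)) auto
    ultimately show ?thesis by simp
  qed
  have "(\<lambda>x. f (N 0) x - g x) \<in> L2 M" using tail[of 0 "N 0"] by (simp add: L2_def)
  then have "(\<lambda>x. f (N 0) x - (f (N 0) x - g x)) \<in> L2 M" using f by (rule L2_diff[rotated])
  then have gL2: "g \<in> L2 M" by simp
  have "(\<lambda>n. L2_norm M (\<lambda>x. f n x - g x)) \<longlonglongrightarrow> 0"
  proof (rule LIMSEQ_I)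
    fix e :: real assume "e > 0"
    then obtain k where "(1/2)^k < e" using real_arch_pow_inv[of e "1/2"] by auto
    then have "\<forall>n\<ge>N k. norm (L2_norm M (\<lambda>x. f n x - g x) - 0) < e"
      using tail by (auto intro: order.strict_trans1)
    then show "\<exists>no. \<forall>n\<ge>no. norm (L2_norm M (\<lambda>x. f n x - g x) - 0) < e" by blast
  qed
  with gL2 show ?thesis by blast
qed

section \<open>Bounded linear maps and weak convergence\<close>

lemma L2_bounded_linear_add:
  "L2_bounded_linear M F \<Longrightarrow> f \<in> L2 M \<Longrightarrow> g \<in> L2 M \<Longrightarrow> F (\<lambda>x. f x + g x) = F f + F g"
  by (simp add: L2_bounded_linear_def)

lemma L2_bounded_linear_scaleR:
  "L2_bounded_linear M F \<Longrightarrow> f \<in> L2 M \<Longrightarrow> F (\<lambda>x. c *\<^sub>R f x) = c *\<^sub>R F f"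
  by (simp add: L2_bounded_linear_def)

lemma L2_bounded_linear_diff:
  assumes F: "L2_bounded_linear M F" and L2: "f \<in> L2 M" "g \<in> L2 M"
  shows "F (\<lambda>x. f x - g x) = F f - F g"
  using L2_bounded_linear_add[OF F L2(1) L2_scaleR[OF L2(2), of "-1"]]
    L2_bounded_linear_scaleR[OF F L2(2), of "-1"] by simp

lemma L2_bounded_linear_bound:
  assumes "L2_bounded_linear M F"
  shows "\<exists>C>0. \<forall>f\<in>L2 M. norm (F f) \<le> C * L2_norm M f"
proof -
  have "\<exists>C. \<forall>f\<in>L2 M. norm (F f) \<le> C * L2_norm M f"
    using assms by (simp only: L2_bounded_linear_def)
  then obtain C where C: "\<And>f. f \<in> L2 M \<Longrightarrow> norm (F f) \<le> C * L2_norm M f"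
    by blast
  have "norm (F f) \<le> (\<bar>C\<bar> + 1) * L2_norm M f" if "f \<in> L2 M" for f
  proof -
    have "C * L2_norm M f \<le> (\<bar>C\<bar> + 1) * L2_norm M f" by (rule mult_right_mono) auto
    with C[OF that] show ?thesis by linarith
  qed
  then show ?thesis by (intro exI[of _ "\<bar>C\<bar> + 1"]) auto
qed

lemma L2_bounded_linear_tendsto:
  assumes F: "L2_bounded_linear M F" and fL2: "\<And>t. f t \<in> L2 M" "g \<in> L2 M"
    and lim: "((\<lambda>t. L2_norm M (\<lambda>x. f t x - g x)) \<longlongrightarrow> 0) net"
  shows "((\<lambda>t. F (f t)) \<longlongrightarrow> F g) net"
proof -
  obtain C where C: "\<And>f. f \<in> L2 M \<Longrightarrow> norm (F f) \<le> C * L2_norm M f"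
    using L2_bounded_linear_bound[OF F] by blast
  have "((\<lambda>t. F (f t) - F g) \<longlongrightarrow> 0) net"
  proof (rule Lim_null_comparison)
    show "((\<lambda>t. C * L2_norm M (\<lambda>x. f t x - g x)) \<longlongrightarrow> 0) net"
      using tendsto_mult_left[OF lim, of C] by simp
    show "\<forall>\<^sub>F t in net. norm (F (f t) - F g) \<le> C * L2_norm M (\<lambda>x. f t x - g x)"
    proof (rule always_eventually, rule allI)
      fix t
      show "norm (F (f t) - F g) \<le> C * L2_norm M (\<lambda>x. f t x - g x)"
        using C[of "\<lambda>x. f t x - g x"] L2_bounded_linear_diff[OF F fL2(1)[of t] fL2(2)] fL2
        by (auto simp: L2_diff)
    qed
  qed
  then show ?thesis by (simp add: LIM_zero_iff)
qed

lemma L2_strong_imp_weakly_tendsto: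
  assumes "\<And>k. f k \<in> L2 M" "g \<in> L2 M" "(\<lambda>k. L2_norm M (\<lambda>x. f k x - g x)) \<longlonglongrightarrow> 0"
  shows "L2_weakly_tendsto M f g"
  unfolding L2_weakly_tendsto_def
proof (intro conjI allI impI)
  fix F :: "('a \<Rightarrow> 'b) \<Rightarrow> real" assume "L2_bounded_linear M F"
  then show "(\<lambda>k. F (f k)) \<longlonglongrightarrow> F g"
    using assms by (rule L2_bounded_linear_tendsto)
qed (use assms in auto)

lemma L2_bounded_linear_inner:
  assumes "g \<in> L2 M"
  shows "L2_bounded_linear M (L2_inner M g)"
  unfolding L2_bounded_linear_def
proof (intro conjI ballI allI exI)
  fix f :: "'a \<Rightarrow> 'b" assume "f \<in> L2 M"
  then show "norm (L2_inner M g f) \<le> L2_norm M g * L2_norm M f"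
    using L2_Cauchy_Schwarz[OF assms] by simp
qed (simp_all add: assms L2_inner_add_right L2_inner_scaleR_right)

subsection \<open>Stability of the mixed variational inequality\<close>

locale vi_operators =
  fixes M :: "'w measure"
    and A :: "('w \<Rightarrow> 'b::euclidean_space) \<Rightarrow> ('w \<Rightarrow> 'b) \<Rightarrow> real"
    and B :: "('w \<Rightarrow> 'b) \<Rightarrow> 'v::{real_inner, complete_space} \<Rightarrow>\<^sub>L real"
    and D :: "'b \<Rightarrow> 'd::euclidean_space"
  assumes A_operator: "L2_dual_operator M A" and A_symmetric: "L2_symmetric M A"
    and A_coercive: "L2_coercive M A" and B_bounded_linear: "L2_bounded_linear M B"
    and linear_D: "linear D" and B_surj: "B ` H_set M D = UNIV"
begin

lemma A_right_bounded_linear: "f \<in> L2 M \<Longrightarrow> L2_bounded_linear M (A f)"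
  using A_operator by (simp add: L2_dual_operator_def)

lemma A_commute: "f \<in> L2 M \<Longrightarrow> g \<in> L2 M \<Longrightarrow> A f g = A g f"
  using A_symmetric by (simp add: L2_symmetric_def)

lemma A_add_left: "f \<in> L2 M \<Longrightarrow> g \<in> L2 M \<Longrightarrow> h \<in> L2 M \<Longrightarrow> A (\<lambda>x. f x + g x) h = A f h + A g h"
  using A_operator by (simp add: L2_dual_operator_def)

lemma A_scaleR_left: "f \<in> L2 M \<Longrightarrow> h \<in> L2 M \<Longrightarrow> A (\<lambda>x. c *\<^sub>R f x) h = c * A f h"
  using A_operator by (simp add: L2_dual_operator_def)

lemma A_scaleR_right: "f \<in> L2 M \<Longrightarrow> h \<in> L2 M \<Longrightarrow> A h (\<lambda>x. c *\<^sub>R f x) = c * A h f"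
  using A_right_bounded_linear[of h] by (simp add: L2_bounded_linear_def)

lemma A_add_right: "f \<in> L2 M \<Longrightarrow> g \<in> L2 M \<Longrightarrow> h \<in> L2 M \<Longrightarrow> A h (\<lambda>x. f x + g x) = A h f + A h g"
  using A_right_bounded_linear[of h] by (simp add: L2_bounded_linear_def)

lemma A_diff_right: "f \<in> L2 M \<Longrightarrow> g \<in> L2 M \<Longrightarrow> h \<in> L2 M \<Longrightarrow> A h (\<lambda>x. f x - g x) = A h f - A h g"
  by (rule L2_bounded_linear_diff[OF A_right_bounded_linear])

lemma A_diff_left: "f \<in> L2 M \<Longrightarrow> g \<in> L2 M \<Longrightarrow> h \<in> L2 M \<Longrightarrow> A (\<lambda>x. f x - g x) h = A f h - A g h"
  using A_diff_right[of f g h] by (simp add: A_commute[of _ h] L2_diff)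

lemma A_bound: "\<exists>C>0. \<forall>f\<in>L2 M. \<forall>h\<in>L2 M. \<bar>A f h\<bar> \<le> C * L2_norm M f * L2_norm M h"
proof -
  obtain C where C: "\<And>f h. f \<in> L2 M \<Longrightarrow> h \<in> L2 M \<Longrightarrow> \<bar>A f h\<bar> \<le> C * L2_norm M f * L2_norm M h"
    using A_operator unfolding L2_dual_operator_def by blast
  have "\<bar>A f h\<bar> \<le> (\<bar>C\<bar> + 1) * L2_norm M f * L2_norm M h" if "f \<in> L2 M" "h \<in> L2 M" for f h
  proof -
    have "C * (L2_norm M f * L2_norm M h) \<le> (\<bar>C\<bar> + 1) * (L2_norm M f * L2_norm M h)"
      by (rule mult_right_mono) auto
    with C[OF that] show ?thesis by (simp only: mult.assoc)
  qed
  then show ?thesis by (intro exI[of _ "\<bar>C\<bar> + 1"]) auto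
qed

lemma A_nonneg: "f \<in> L2 M \<Longrightarrow> 0 \<le> A f f"
  using A_coercive unfolding L2_coercive_def
  by (metis less_imp_le mult_nonneg_nonneg order_trans zero_le_power2)

lemma A_tendsto:
  assumes L2: "\<And>t. f t \<in> L2 M" "\<And>t. g t \<in> L2 M" "f' \<in> L2 M" "g' \<in> L2 M"
    and f: "((\<lambda>t. L2_norm M (\<lambda>x. f t x - f' x)) \<longlongrightarrow> 0) net"
    and g: "((\<lambda>t. L2_norm M (\<lambda>x. g t x - g' x)) \<longlongrightarrow> 0) net"
  shows "((\<lambda>t. A (f t) (g t)) \<longlongrightarrow> A f' g') net"
proof -
  obtain C where C: "C > 0" "\<And>f h. f \<in> L2 M \<Longrightarrow> h \<in> L2 M \<Longrightarrow> \<bar>A f h\<bar> \<le> C * L2_norm M f * L2_norm M h"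
    using A_bound by blast
  let ?a = "\<lambda>t. L2_norm M (\<lambda>x. f t x - f' x)" and ?b = "\<lambda>t. L2_norm M (\<lambda>x. g t x - g' x)"
  have "((\<lambda>t. A (f t) (g t) - A f' g') \<longlongrightarrow> 0) net"
  proof (rule Lim_null_comparison)
    have "((\<lambda>t. C * ?a t * (L2_norm M g' + ?b t) + C * L2_norm M f' * ?b t)
        \<longlongrightarrow> C * 0 * (L2_norm M g' + 0) + C * L2_norm M f' * 0) net"
      using f g by (intro tendsto_intros)
    then show "((\<lambda>t. C * ?a t * (L2_norm M g' + ?b t) + C * L2_norm M f' * ?b t) \<longlongrightarrow> 0) net"
      by simp
    show "\<forall>\<^sub>F t in net. norm (A (f t) (g t) - A f' g')
        \<le> C * ?a t * (L2_norm M g' + ?b t) + C * L2_norm M f' * ?b t"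
    proof (rule always_eventually, rule allI)
      fix t
      have "A (f t) (g t) - A f' g' = A (\<lambda>x. f t x - f' x) (g t) + A f' (\<lambda>x. g t x - g' x)"
        using L2 by (simp add: A_diff_left A_diff_right)
      moreover have "\<bar>A (\<lambda>x. f t x - f' x) (g t)\<bar> \<le> C * ?a t * L2_norm M (g t)"
        using L2 by (intro C(2)) auto
      moreover have "C * ?a t * L2_norm M (g t) \<le> C * ?a t * (L2_norm M g' + ?b t)"
        using L2 C(1) by (intro mult_left_mono L2_norm_triangle_sub) auto
      moreover have "\<bar>A f' (\<lambda>x. g t x - g' x)\<bar> \<le> C * L2_norm M f' * ?b t"
        using L2 by (intro C(2)) auto
      ultimately show "norm (A (f t) (g t) - A f' g')
        \<le> C * ?a t * (L2_norm M g' + ?b t) + C * L2_norm M f' * ?b t"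
        by simp
    qed
  qed
  then show ?thesis by (simp add: LIM_zero_iff)
qed

lemma B_diff: "f \<in> L2 M \<Longrightarrow> g \<in> L2 M \<Longrightarrow> B (\<lambda>x. f x - g x) = B f - B g"
  by (rule L2_bounded_linear_diff[OF B_bounded_linear])

lemma B_add: "f \<in> L2 M \<Longrightarrow> g \<in> L2 M \<Longrightarrow> B (\<lambda>x. f x + g x) = B f + B g"
  using B_bounded_linear by (simp add: L2_bounded_linear_def)

lemma B_scaleR: "f \<in> L2 M \<Longrightarrow> B (\<lambda>x. c *\<^sub>R f x) = c *\<^sub>R B f"
  using B_bounded_linear by (simp add: L2_bounded_linear_def)

lemma H_set_L2: "h \<in> H_set M D \<Longrightarrow> h \<in> L2 M"
  by (simp add: H_set_def)

lemma H_set_uminus: "h \<in> H_set M D \<Longrightarrow> (\<lambda>x. - h x) \<in> H_set M D"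
  by (auto simp: H_set_def linear_neg[OF linear_D] L2_uminus)

text \<open>
  Surjectivity of \<open>B\<close> on \<open>H\<close> enters only through this inf-sup estimate: the vectors tested by \<open>H\<close>
  with constant one are pointwise bounded as functionals, hence bounded.
\<close>

lemma inf_sup_bound:
  "\<exists>C>0. \<forall>v c. 0 \<le> c \<longrightarrow> (\<forall>h\<in>H_set M D. \<bar>blinfun_apply (B h) v\<bar> \<le> c * L2_norm M h) \<longrightarrow> norm v \<le> C * c"
proof -
  define S where "S = {v. \<forall>h\<in>H_set M D. \<bar>blinfun_apply (B h) v\<bar> \<le> L2_norm M h}"
  have "\<exists>c. \<forall>v\<in>S. \<bar>y \<bullet> v\<bar> \<le> c" for y
  proof -
    \<comment> \<open>By surjectivity the pairing with \<open>y\<close> is itself of the form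
      \<open>B h\<close>, and membership of \<open>v\<close> in \<open>S\<close> bounds its value by
      the norm of \<open>h\<close>, uniformly in \<open>v\<close>.\<close>
    obtain h where h: "h \<in> H_set M D" "B h = blinfun_inner_left y"
      using B_surj by (metis UNIV_I image_iff)
    have "\<bar>y \<bullet> v\<bar> \<le> L2_norm M h" if "v \<in> S" for v
      using that h by (auto simp: S_def inner_commute dest!: bspec[of _ _ h])
    then show ?thesis by blast
  qed
  then obtain C where C: "C > 0" "\<And>v. v \<in> S \<Longrightarrow> norm v \<le> C"
    using uniform_boundedness_hilbert[of S] by blast
  have "norm v \<le> C * c"
    if c: "0 \<le> c" and v: "\<forall>h\<in>H_set M D. \<bar>blinfun_apply (B h) v\<bar> \<le> c * L2_norm M h" for v c
  proof (rule field_le_epsilon)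
    fix e :: real assume e: "e > 0"
    \<comment> \<open>The bound \<open>c\<close> may be zero, so \<open>v\<close> is normalised by a
      slightly larger positive number; the excess contributes only \<open>e\<close> to the final
      estimate.\<close>
    define c' where "c' = c + e / C"
    have c': "c' > 0" using c e C by (simp add: c'_def add_nonneg_pos)
    have "inverse c' *\<^sub>R v \<in> S"
    proof -
      have "\<bar>blinfun_apply (B h) (inverse c' *\<^sub>R v)\<bar> \<le> L2_norm M h" if h: "h \<in> H_set M D" for h
      proof -
        have "\<bar>blinfun_apply (B h) v\<bar> \<le> c' * L2_norm M h"
          using v h e C by (intro order_trans[OF bspec[OF v h]] mult_right_mono) (auto simp: c'_def)
        then show ?thesis
          using c' by (simp add: blinfun.scaleR_right abs_mult field_simps)
      qed
      then show ?thesis by (simp add: S_def)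
    qed
    then have "norm (inverse c' *\<^sub>R v) \<le> C" by (rule C(2))
    then have "norm v \<le> C * c'" using c' by (simp add: field_simps)
    also have "\<dots> = C * c + e" using C by (simp add: c'_def field_simps)
    finally show "norm v \<le> C * c + e" .
  qed
  with C(1) show ?thesis by blast
qed

section \<open>Equations contained in the variational inequality\<close>

lemma solves_VI_K: "solves_VI M A B D l (S, u) \<Longrightarrow> S \<in> K_set M D"
  by (simp add: solves_VI_def)

lemma solves_VI_L2: "solves_VI M A B D l (S, u) \<Longrightarrow> S \<in> L2 M"
  by (simp add: solves_VI_def K_set_def)

lemma A_zero_right: "f \<in> L2 M \<Longrightarrow> A f (\<lambda>x. 0) = 0"
  using A_scaleR_right[of f f 0] by simp

lemma B_zero: "B (\<lambda>x. 0) = 0"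
  using B_scaleR[of "\<lambda>x. 0" 0] by simp

lemma blinfun_nonpos_imp_0:
  fixes l :: "'v \<Rightarrow>\<^sub>L real"
  assumes "\<And>v. blinfun_apply l v \<le> 0"
  shows "l = 0"
proof (rule blinfun_eqI)
  fix v
  show "blinfun_apply l v = blinfun_apply 0 v"
    using assms[of v] assms[of "-v"] by (simp add: blinfun.minus_right)
qed

text \<open>The second component is tested by a whole vector space: for \<open>T = S\<close> only
  the term linear in \<open>v - u\<close> survives, and a functional that is nowhere positive is
  zero.\<close>

lemma solves_VI_B:
  assumes "solves_VI M A B D l (S, u)"
  shows "B S = l"
proof -
  have "blinfun_apply (B S - l) w \<le> 0" for w
  proof -
    have "A S (\<lambda>x. S x - S x) + B_star B u (\<lambda>x. S x - S x) - blinfun_apply (B S - l) ((u + w) - u) \<ge> 0"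
      using assms unfolding solves_VI_def by blast
    then show ?thesis
      using solves_VI_L2[OF assms] by (simp add: A_zero_right B_zero B_star_def)
  qed
  from blinfun_nonpos_imp_0[OF this] show ?thesis by simp
qed

lemma solves_VI_ineq:
  assumes "solves_VI M A B D l (S, u)" "T \<in> K_set M D"
  shows "A S (\<lambda>x. T x - S x) + blinfun_apply (B (\<lambda>x. T x - S x)) u \<ge> 0"
proof -
  have "A S (\<lambda>x. T x - S x) + B_star B u (\<lambda>x. T x - S x) - blinfun_apply (B S - l) (u - u) \<ge> 0"
    using assms unfolding solves_VI_def by blast
  then show ?thesis by (simp add: B_star_def blinfun.zero_right)
qed

lemma K_set_add_H:
  assumes "S \<in> K_set M D" "h \<in> H_set M D"
  shows "(\<lambda>x. S x + h x) \<in> K_set M D"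
  using assms by (auto simp: K_set_def H_set_def linear_add[OF linear_D] elim: eventually_elim2)

text \<open>\<open>K_set M D\<close> is invariant under translation by \<open>H_set M D\<close>, so
  the inequality holds for \<open>h\<close> and for its negative. This equation is what lets the
  inf-sup estimate control \<open>u\<close> by \<open>S\<close>.\<close>

lemma solves_VI_H:
  assumes VI: "solves_VI M A B D l (S, u)" and h: "h \<in> H_set M D"
  shows "A S h = - blinfun_apply (B h) u"
proof -
  have "A S g + blinfun_apply (B g) u \<ge> 0" if "g \<in> H_set M D" for g
    using solves_VI_ineq[OF VI K_set_add_H[OF solves_VI_K[OF VI] that]] by simp
  from this[OF h] this[OF H_set_uminus[OF h]] show ?thesis
    using A_scaleR_right[OF H_set_L2[OF h] solves_VI_L2[OF VI], of "-1"]
      B_scaleR[OF H_set_L2[OF h], of "-1"]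
    by (simp add: blinfun.minus_left)
qed

text \<open>Subtracting the two equations expresses the values at
  \<open>u\<^sub>1 - u\<^sub>2\<close> through \<open>A\<close>, and the inf-sup estimate applies.
  Assuming only the equations on \<open>H_set M D\<close> makes the bound serve solutions,
  difference quotients, their limits and solutions of the linearised problem alike.\<close>

lemma multiplier_Lipschitz:
  "\<exists>C>0. \<forall>S\<^sub>1 S\<^sub>2 u\<^sub>1 u\<^sub>2. S\<^sub>1 \<in> L2 M \<longrightarrow> S\<^sub>2 \<in> L2 M \<longrightarrow>
     (\<forall>h\<in>H_set M D. A S\<^sub>1 h = - blinfun_apply (B h) u\<^sub>1) \<longrightarrow>
     (\<forall>h\<in>H_set M D. A S\<^sub>2 h = - blinfun_apply (B h) u\<^sub>2) \<longrightarrow>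
     norm (u\<^sub>1 - u\<^sub>2) \<le> C * L2_norm M (\<lambda>x. S\<^sub>1 x - S\<^sub>2 x)"
proof -
  obtain C where C: "C > 0"
    "\<And>v c. 0 \<le> c \<Longrightarrow> \<forall>h\<in>H_set M D. \<bar>blinfun_apply (B h) v\<bar> \<le> c * L2_norm M h \<Longrightarrow> norm v \<le> C * c"
    using inf_sup_bound by blast
  obtain CA where CA: "CA > 0"
    "\<And>f h. f \<in> L2 M \<Longrightarrow> h \<in> L2 M \<Longrightarrow> \<bar>A f h\<bar> \<le> CA * L2_norm M f * L2_norm M h"
    using A_bound by blast
  have "norm (u\<^sub>1 - u\<^sub>2) \<le> C * CA * L2_norm M (\<lambda>x. S\<^sub>1 x - S\<^sub>2 x)"
    if L2: "S\<^sub>1 \<in> L2 M" "S\<^sub>2 \<in> L2 M"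
      and e: "\<forall>h\<in>H_set M D. A S\<^sub>1 h = - blinfun_apply (B h) u\<^sub>1"
        "\<forall>h\<in>H_set M D. A S\<^sub>2 h = - blinfun_apply (B h) u\<^sub>2" for S\<^sub>1 S\<^sub>2 u\<^sub>1 u\<^sub>2
    unfolding mult.assoc
  proof (rule C(2))
    show "\<forall>h\<in>H_set M D. \<bar>blinfun_apply (B h) (u\<^sub>1 - u\<^sub>2)\<bar>
        \<le> CA * L2_norm M (\<lambda>x. S\<^sub>1 x - S\<^sub>2 x) * L2_norm M h"
    proof
      fix h assume h: "h \<in> H_set M D"
      have "blinfun_apply (B h) (u\<^sub>1 - u\<^sub>2) = - A (\<lambda>x. S\<^sub>1 x - S\<^sub>2 x) h"
        using e h L2 H_set_L2 by (simp add: blinfun.diff_right A_diff_left)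
      then show "\<bar>blinfun_apply (B h) (u\<^sub>1 - u\<^sub>2)\<bar>
          \<le> CA * L2_norm M (\<lambda>x. S\<^sub>1 x - S\<^sub>2 x) * L2_norm M h"
        using CA(2)[OF L2_diff[OF L2] H_set_L2[OF h]] by simp
    qed
  qed (use CA in auto)
  then show ?thesis using C(1) CA(1) by (intro exI[of _ "C * CA"]) auto
qed

text \<open>Each solution is a test function for the other inequality. In the sum, the equations
  \<open>B S = l\<close> reduce the coupling to the pairing of \<open>l\<^sub>1 - l\<^sub>2\<close>
  with \<open>u\<^sub>1 - u\<^sub>2\<close>; bounding the latter by
  \<open>multiplier_Lipschitz\<close> allows one factor of the quadratic estimate to be
  cancelled.\<close>

lemma solution_Lipschitz:
  "\<exists>L>0. \<forall>l\<^sub>1 l\<^sub>2 S\<^sub>1 S\<^sub>2 u\<^sub>1 u\<^sub>2. solves_VI M A B D l\<^sub>1 (S\<^sub>1, u\<^sub>1) \<longrightarrow> solves_VI M A B D l\<^sub>2 (S\<^sub>2, u\<^sub>2) \<longrightarrow>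
     L2_norm M (\<lambda>x. S\<^sub>1 x - S\<^sub>2 x) \<le> L * norm (l\<^sub>1 - l\<^sub>2) \<and> norm (u\<^sub>1 - u\<^sub>2) \<le> L * norm (l\<^sub>1 - l\<^sub>2)"
proof -
  obtain C where C: "C > 0"
    "\<And>S\<^sub>1 S\<^sub>2 u\<^sub>1 u\<^sub>2. S\<^sub>1 \<in> L2 M \<Longrightarrow> S\<^sub>2 \<in> L2 M \<Longrightarrow> \<forall>h\<in>H_set M D. A S\<^sub>1 h = - blinfun_apply (B h) u\<^sub>1 \<Longrightarrow>
      \<forall>h\<in>H_set M D. A S\<^sub>2 h = - blinfun_apply (B h) u\<^sub>2 \<Longrightarrow>
      norm (u\<^sub>1 - u\<^sub>2) \<le> C * L2_norm M (\<lambda>x. S\<^sub>1 x - S\<^sub>2 x)"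
    using multiplier_Lipschitz by blast
  obtain a where a: "a > 0" "\<And>f. f \<in> L2 M \<Longrightarrow> A f f \<ge> a * (L2_norm M f)\<^sup>2"
    using A_coercive unfolding L2_coercive_def by blast
  \<comment> \<open>The first summand is the constant for the \<open>S\<close> component, the second
    the one for the \<open>u\<close> component.\<close>
  define L where "L = C / a + C * (C / a)"
  have main: "L2_norm M (\<lambda>x. S\<^sub>1 x - S\<^sub>2 x) \<le> L * norm (l\<^sub>1 - l\<^sub>2) \<and> norm (u\<^sub>1 - u\<^sub>2) \<le> L * norm (l\<^sub>1 - l\<^sub>2)"
    if VI: "solves_VI M A B D l\<^sub>1 (S\<^sub>1, u\<^sub>1)" "solves_VI M A B D l\<^sub>2 (S\<^sub>2, u\<^sub>2)" for l\<^sub>1 l\<^sub>2 S\<^sub>1 S\<^sub>2 u\<^sub>1 u\<^sub>2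
  proof -
    let ?d = "\<lambda>x. S\<^sub>1 x - S\<^sub>2 x" and ?l = "l\<^sub>1 - l\<^sub>2"
    have L2: "S\<^sub>1 \<in> L2 M" "S\<^sub>2 \<in> L2 M" using VI by (auto dest: solves_VI_L2)
    have u: "norm (u\<^sub>1 - u\<^sub>2) \<le> C * L2_norm M ?d"
      using solves_VI_H VI by (intro C(2) L2) auto
    have i1: "A S\<^sub>1 S\<^sub>2 - A S\<^sub>1 S\<^sub>1 + blinfun_apply (l\<^sub>2 - l\<^sub>1) u\<^sub>1 \<ge> 0"
      using solves_VI_ineq[OF VI(1) solves_VI_K[OF VI(2)]] L2 VI
      by (simp add: A_diff_right B_diff solves_VI_B)
    have i2: "A S\<^sub>2 S\<^sub>1 - A S\<^sub>2 S\<^sub>2 + blinfun_apply (l\<^sub>1 - l\<^sub>2) u\<^sub>2 \<ge> 0"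
      using solves_VI_ineq[OF VI(2) solves_VI_K[OF VI(1)]] L2 VI
      by (simp add: A_diff_right B_diff solves_VI_B)
    have "a * (L2_norm M ?d)\<^sup>2 \<le> A ?d ?d" using L2 by (intro a(2)) auto
    also have "\<dots> \<le> - blinfun_apply ?l (u\<^sub>1 - u\<^sub>2)"
      using i1 i2 L2 by (simp add: A_diff_left A_diff_right L2_diff blinfun.diff_left blinfun.diff_right)
    also have "\<dots> \<le> norm ?l * norm (u\<^sub>1 - u\<^sub>2)"
      using norm_blinfun[of ?l "u\<^sub>1 - u\<^sub>2"] by simp
    also have "\<dots> \<le> norm ?l * (C * L2_norm M ?d)" by (intro mult_left_mono u) auto
    finally have "L2_norm M ?d * (a * L2_norm M ?d) \<le> L2_norm M ?d * (C * norm ?l)"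
      by (simp add: power2_eq_square mult_ac)
    then have "a * L2_norm M ?d \<le> C * norm ?l"
      using C(1) L2_norm_nonneg[of M ?d]
      by (cases "L2_norm M ?d = 0") (auto simp: mult_le_cancel_left)
    then have 1: "L2_norm M ?d \<le> C / a * norm ?l" using a(1) by (simp add: field_simps)
    moreover have "C / a * norm ?l \<le> L * norm ?l"
      unfolding L_def using a C by (intro mult_right_mono) auto
    moreover have "norm (u\<^sub>1 - u\<^sub>2) \<le> C * (C / a * norm ?l)"
      using u 1 C(1) by (meson less_imp_le mult_left_mono order_trans)
    moreover have "C * (C / a * norm ?l) \<le> L * norm ?l"
      unfolding L_def mult.assoc[symmetric] using a C by (intro mult_right_mono) auto
    ultimately show ?thesis by linarith
  qed
  have "L > 0" unfolding L_def using a C by (simp add: add_pos_pos)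
  with main show ?thesis by blast
qed

end

subsection \<open>The critical cone and the curvature form\<close>

locale vi_solution = vi_operators M A B D
  for M :: "'w measure"
    and A :: "('w \<Rightarrow> 'b::euclidean_space) \<Rightarrow> ('w \<Rightarrow> 'b) \<Rightarrow> real"
    and B :: "('w \<Rightarrow> 'b) \<Rightarrow> 'v::{real_inner, complete_space} \<Rightarrow>\<^sub>L real"
    and D :: "'b \<Rightarrow> 'd::euclidean_space" +
  fixes Sig :: "('v \<Rightarrow>\<^sub>L real) \<Rightarrow> 'w \<Rightarrow> 'b"
    and u :: "('v \<Rightarrow>\<^sub>L real) \<Rightarrow> 'v"
    and l0 :: "'v \<Rightarrow>\<^sub>L real"
    and Xi0 :: "'w \<Rightarrow> 'b"
    and lam0 :: "'w \<Rightarrow> real"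
  assumes VI: "solves_VI M A B D l (Sig l, u l)"
    and Xi0_L2: "Xi0 \<in> L2 M"
    and Xi0_eq: "T \<in> L2 M \<Longrightarrow> L2_inner M Xi0 T = - A (Sig l0) T - B_star B (u l0) T"
    and lam0_L2: "lam0 \<in> L2 M" and lam0_nonneg: "AE x in M. lam0 x \<ge> 0"
    and lam0_zero: "AE x in M. norm (D (Sig l0 x)) < 1 \<longrightarrow> lam0 x = 0"
    and lam0_eq: "T \<in> L2 M \<Longrightarrow> A (Sig l0) T + B_star B (u l0) T
           + L2_inner M (\<lambda>x. lam0 x *\<^sub>R adjoint D (D (Sig l0 x))) T = 0"
begin

abbreviation "S0 \<equiv> Sig l0"

lemma Sig_L2 [simp]: "Sig l \<in> L2 M"
  using VI[of l] by (rule solves_VI_L2)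

lemma D_measurable [measurable]: "D \<in> borel_measurable borel"
  using linear_D by (simp add: borel_measurable_continuous_onI linear_continuous_on linear_conv_bounded_linear)

lemma lam0_measurable [measurable]: "lam0 \<in> borel_measurable M"
  using lam0_L2 by (rule L2_measurable)

lemma Sig_measurable [measurable]: "Sig l \<in> borel_measurable M"
  using Sig_L2 by (rule L2_measurable)

lemma D_S0_le: "AE x in M. norm (D (S0 x)) \<le> 1"
  using VI[of l0] by (simp add: solves_VI_def K_set_def)

lemma D_L2: "T \<in> L2 M \<Longrightarrow> (\<lambda>x. D (T x)) \<in> L2 M"
  using linear_D by (rule L2_linear_image)

text \<open>\<open>lam0\<close> and \<open>D T\<close> are square-integrable and \<open>D S0\<close>
  is bounded by one, so this product, linear in \<open>T\<close>, is always integrable. Its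
  quadratic counterpart has no such majorant.\<close>

lemma Xi0_inner_integrable:
  assumes T: "T \<in> L2 M"
  shows "integrable M (\<lambda>x. lam0 x * (D (S0 x) \<bullet> D (T x)))"
proof (rule Bochner_Integration.integrable_bound)
  have [measurable]: "T \<in> borel_measurable M" using T by (rule L2_measurable)
  have "(\<lambda>x. norm (D (T x))) \<in> L2 M"
    by (rule L2_bound[OF D_L2[OF T], of _ 1]) auto
  then show "integrable M (\<lambda>x. lam0 x \<bullet> norm (D (T x)))"
    by (rule L2_integrable_inner[OF lam0_L2])
  show "(\<lambda>x. lam0 x * (D (S0 x) \<bullet> D (T x))) \<in> borel_measurable M" by measurable
  show "AE x in M. norm (lam0 x * (D (S0 x) \<bullet> D (T x))) \<le> norm (lam0 x \<bullet> norm (D (T x)))"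
    using D_S0_le
  proof eventually_elim
    case (elim x)
    have "\<bar>D (S0 x) \<bullet> D (T x)\<bar> \<le> norm (D (S0 x)) * norm (D (T x))" by (rule Cauchy_Schwarz_ineq2)
    also have "\<dots> \<le> 1 * norm (D (T x))" using elim by (intro mult_right_mono) auto
    finally show ?case by (simp add: abs_mult mult_left_mono)
  qed
qed

text \<open>\<open>Xi0\<close> and the term with \<open>lam0\<close> represent the same functional.
  In this form the sign of \<open>D (S0 x) \<bullet> D (T x)\<close> controls the pairing with
  \<open>Xi0\<close>.\<close>

lemma Xi0_inner:
  assumes T: "T \<in> L2 M"
  shows "L2_inner M Xi0 T = (LINT x|M. lam0 x * (D (S0 x) \<bullet> D (T x)))"
  using Xi0_eq[OF T] lam0_eq[OF T] by (simp add: L2_inner_def adjoint_clauses[OF linear_D])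

section \<open>The curvature form and the relaxed critical cones\<close>

text \<open>The domain of the curvature form. On it the integrals in \<open>p\<close> and
  \<open>q\<close> are genuine and split additively; outside it \<open>q\<close> takes the default
  value zero.\<close>

definition Wt :: "('w \<Rightarrow> 'b) set" where
  "Wt = {T \<in> L2 M. integrable M (\<lambda>x. lam0 x * (norm (D (T x)))\<^sup>2)}"

definition p :: "('w \<Rightarrow> 'b) \<Rightarrow> ('w \<Rightarrow> 'b) \<Rightarrow> real" where
  "p S T = (LINT x|M. lam0 x * (D (S x) \<bullet> D (T x)))"

definition q :: "('w \<Rightarrow> 'b) \<Rightarrow> real" where
  "q T = (LINT x|M. lam0 x * (norm (D (T x)))\<^sup>2)"

lemma Wt_L2: "T \<in> Wt \<Longrightarrow> T \<in> L2 M"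
  by (simp add: Wt_def)

lemma q_eq_p: "q T = p T T"
  by (simp add: p_def q_def power2_norm_eq_inner)

lemma q_nonneg: "0 \<le> q T"
  unfolding q_def by (rule integral_nonneg_AE) (use lam0_nonneg in auto)

lemma p_commute: "p S T = p T S"
  by (simp add: p_def inner_commute)

lemma p_integrable:
  assumes S: "S \<in> Wt" and T: "T \<in> Wt"
  shows "integrable M (\<lambda>x. lam0 x * (D (S x) \<bullet> D (T x)))"
proof (rule Bochner_Integration.integrable_bound)
  have [measurable]: "S \<in> borel_measurable M" "T \<in> borel_measurable M"
    using assms by (auto intro: L2_measurable simp: Wt_def)
  show "integrable M (\<lambda>x. lam0 x * (norm (D (S x)))\<^sup>2 + lam0 x * (norm (D (T x)))\<^sup>2)"
    using assms by (simp add: Wt_def)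
  show "(\<lambda>x. lam0 x * (D (S x) \<bullet> D (T x))) \<in> borel_measurable M" by measurable
  show "AE x in M. norm (lam0 x * (D (S x) \<bullet> D (T x)))
      \<le> norm (lam0 x * (norm (D (S x)))\<^sup>2 + lam0 x * (norm (D (T x)))\<^sup>2)"
    using lam0_nonneg
  proof eventually_elim
    case (elim x)
    have "\<bar>D (S x) \<bullet> D (T x)\<bar> \<le> norm (D (S x)) * norm (D (T x))" by (rule Cauchy_Schwarz_ineq2)
    also have "\<dots> \<le> (norm (D (S x)))\<^sup>2 + (norm (D (T x)))\<^sup>2"
      using sum_squares_bound[of "norm (D (S x))" "norm (D (T x))"]
        mult_nonneg_nonneg[OF norm_ge_zero norm_ge_zero, of "D (S x)" "D (T x)"] by linarith
    finally have "lam0 x * \<bar>D (S x) \<bullet> D (T x)\<bar> \<le> lam0 x * ((norm (D (S x)))\<^sup>2 + (norm (D (T x)))\<^sup>2)"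
      using elim by (rule mult_left_mono)
    then show ?case using elim by (simp add: abs_mult distrib_left)
  qed
qed

lemma Wt_add: 
  assumes "S \<in> Wt" "T \<in> Wt"
  shows "(\<lambda>x. S x + T x) \<in> Wt"
proof -
  have "integrable M (\<lambda>x. lam0 x * (norm (D (S x)))\<^sup>2 + 2 * (lam0 x * (D (S x) \<bullet> D (T x)))
      + lam0 x * (norm (D (T x)))\<^sup>2)"
    using assms p_integrable[OF assms] by (simp add: Wt_def)
  also have "(\<lambda>x. lam0 x * (norm (D (S x)))\<^sup>2 + 2 * (lam0 x * (D (S x) \<bullet> D (T x)))
      + lam0 x * (norm (D (T x)))\<^sup>2) = (\<lambda>x. lam0 x * (norm (D (S x + T x)))\<^sup>2)"
    by (simp add: linear_add[OF linear_D] power2_norm_eq_inner inner_add_left inner_add_right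
        inner_commute algebra_simps)
  finally show ?thesis using assms by (auto simp: Wt_def)
qed

lemma Wt_scaleR:
  assumes "S \<in> Wt"
  shows "(\<lambda>x. c *\<^sub>R S x) \<in> Wt"
proof -
  have "integrable M (\<lambda>x. c\<^sup>2 * (lam0 x * (norm (D (S x)))\<^sup>2))"
    using assms by (simp add: Wt_def)
  also have "(\<lambda>x. c\<^sup>2 * (lam0 x * (norm (D (S x)))\<^sup>2)) = (\<lambda>x. lam0 x * (norm (D (c *\<^sub>R S x)))\<^sup>2)"
    by (simp add: linear_scale[OF linear_D] power_mult_distrib mult_ac)
  finally show ?thesis using assms by (auto simp: Wt_def)
qed

lemma Wt_diff: "S \<in> Wt \<Longrightarrow> T \<in> Wt \<Longrightarrow> (\<lambda>x. S x - T x) \<in> Wt"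
  using Wt_add[OF _ Wt_scaleR, of S T "-1"] by simp

lemma p_add_right:
  assumes "S \<in> Wt" "T \<in> Wt" "R \<in> Wt"
  shows "p R (\<lambda>x. S x + T x) = p R S + p R T"
  using assms by (simp add: p_def linear_add[OF linear_D] inner_add_right distrib_left p_integrable)

lemma p_diff_right:
  assumes "S \<in> Wt" "T \<in> Wt" "R \<in> Wt"
  shows "p R (\<lambda>x. S x - T x) = p R S - p R T"
  using assms by (simp add: p_def linear_diff[OF linear_D] inner_diff_right right_diff_distrib p_integrable)

lemma p_diff_left:
  assumes "S \<in> Wt" "T \<in> Wt" "R \<in> Wt"
  shows "p (\<lambda>x. S x - T x) R = p S R - p T R"
  using p_diff_right[OF assms] by (simp add: p_commute)

lemma p_scaleR_right: "p R (\<lambda>x. c *\<^sub>R S x) = c * p R S"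
  by (simp add: p_def linear_scale[OF linear_D] mult.left_commute)

lemma q_add:
  assumes "S \<in> Wt" "T \<in> Wt"
  shows "q (\<lambda>x. S x + T x) = q S + 2 * p S T + q T"
proof -
  let ?s = "\<lambda>x. S x + T x"
  have "p ?s S = p S S + p S T" "p ?s T = p S T + p T T"
    using p_add_right[OF assms assms(1)] p_add_right[OF assms assms(2)]
    by (simp_all add: p_commute[of ?s] p_commute[of T S])
  then show ?thesis
    using p_add_right[OF assms Wt_add[OF assms]] by (simp add: q_eq_p)
qed

lemma q_scaleR: "q (\<lambda>x. c *\<^sub>R S x) = c\<^sup>2 * q S"
  by (simp add: q_eq_p p_scaleR_right p_commute[of "\<lambda>x. c *\<^sub>R S x"] power2_eq_square)

text \<open>
  The cone of critical directions is \<open>relaxed_cone 0\<close>; the relaxed cones with \<open>e > 0\<close> also contain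
  difference quotients.
\<close>

definition relaxed_cone :: "real \<Rightarrow> ('w \<Rightarrow> 'b) set" where
  "relaxed_cone e = {T \<in> Wt. (AE x in M. norm (D (S0 x)) = 1 \<longrightarrow> D (S0 x) \<bullet> D (T x) \<le> 0) \<and>
     - e \<le> L2_inner M Xi0 T}"

lemma relaxed_cone_Wt: "T \<in> relaxed_cone e \<Longrightarrow> T \<in> Wt"
  by (simp add: relaxed_cone_def)

lemma relaxed_cone_L2: "T \<in> relaxed_cone e \<Longrightarrow> T \<in> L2 M"
  by (simp add: relaxed_cone_def Wt_L2)

lemma relaxed_cone_mono: "e \<le> e' \<Longrightarrow> T \<in> relaxed_cone e \<Longrightarrow> T \<in> relaxed_cone e'"
  by (auto simp: relaxed_cone_def)

lemma relaxed_cone_add: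
  assumes "S \<in> relaxed_cone e" "T \<in> relaxed_cone e'"
  shows "(\<lambda>x. S x + T x) \<in> relaxed_cone (e + e')"
proof -
  have "AE x in M. norm (D (S0 x)) = 1 \<longrightarrow> D (S0 x) \<bullet> D (S x) \<le> 0"
    "AE x in M. norm (D (S0 x)) = 1 \<longrightarrow> D (S0 x) \<bullet> D (T x) \<le> 0"
    using assms by (auto simp: relaxed_cone_def)
  then have "AE x in M. norm (D (S0 x)) = 1 \<longrightarrow> D (S0 x) \<bullet> D (S x + T x) \<le> 0"
    by eventually_elim (auto simp: linear_add[OF linear_D] inner_add_right)
  moreover have "(\<lambda>x. S x + T x) \<in> Wt"
    using assms by (auto simp: relaxed_cone_def intro: Wt_add)
  moreover have "L2_inner M Xi0 (\<lambda>x. S x + T x) = L2_inner M Xi0 S + L2_inner M Xi0 T"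
    using assms by (intro L2_inner_add_right Xi0_L2) (auto dest: relaxed_cone_L2)
  ultimately show ?thesis using assms by (auto simp: relaxed_cone_def)
qed

lemma relaxed_cone_scaleR:
  assumes "S \<in> relaxed_cone e" "0 \<le> c"
  shows "(\<lambda>x. c *\<^sub>R S x) \<in> relaxed_cone (c * e)"
proof -
  have "AE x in M. norm (D (S0 x)) = 1 \<longrightarrow> D (S0 x) \<bullet> D (S x) \<le> 0"
    using assms by (auto simp: relaxed_cone_def)
  then have "AE x in M. norm (D (S0 x)) = 1 \<longrightarrow> D (S0 x) \<bullet> D (c *\<^sub>R S x) \<le> 0"
    by eventually_elim (use assms(2) in \<open>auto simp: linear_scale[OF linear_D] mult_le_0_iff\<close>)
  moreover have "- (c * e) \<le> L2_inner M Xi0 (\<lambda>x. c *\<^sub>R S x)"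
    using assms mult_left_mono[of "-e" "L2_inner M Xi0 S" c] by (simp add: relaxed_cone_def L2_inner_scaleR_right)
  ultimately show ?thesis using assms by (auto simp: relaxed_cone_def intro: Wt_scaleR)
qed

lemma relaxed_cone_convex:
  assumes "S \<in> relaxed_cone e" "T \<in> relaxed_cone e" "0 \<le> s" "s \<le> 1"
  shows "(\<lambda>x. (1 - s) *\<^sub>R S x + s *\<^sub>R T x) \<in> relaxed_cone e"
  using relaxed_cone_add[OF relaxed_cone_scaleR[OF assms(1), of "1 - s"] relaxed_cone_scaleR[OF assms(2), of s]] assms(3,4)
  by (simp add: algebra_simps)

text \<open>Off the active set the factor \<open>lam0 x\<close> vanishes, so a sign condition on the
  active set suffices.\<close>

lemma lam0_inner_nonpos:
  assumes "AE x in M. norm (D (S0 x)) = 1 \<longrightarrow> D (S0 x) \<bullet> D (T x) \<le> 0"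
  shows "AE x in M. lam0 x * (D (S0 x) \<bullet> D (T x)) \<le> 0"
  using assms D_S0_le lam0_zero lam0_nonneg
  by eventually_elim (auto simp: mult_le_0_iff less_le)

text \<open>Tangency makes the integrand nonpositive, while the slack zero makes its integral
  nonnegative; so it vanishes almost everywhere.\<close>

lemma relaxed_cone_0_complementary:
  assumes "T \<in> relaxed_cone 0"
  shows "AE x in M. lam0 x * (D (S0 x) \<bullet> D (T x)) = 0"
proof -
  have T: "T \<in> L2 M" using assms by (rule relaxed_cone_L2)
  have np: "AE x in M. lam0 x * (D (S0 x) \<bullet> D (T x)) \<le> 0"
    using assms by (intro lam0_inner_nonpos) (simp add: relaxed_cone_def)
  have int: "integrable M (\<lambda>x. - (lam0 x * (D (S0 x) \<bullet> D (T x))))"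
    using Xi0_inner_integrable[OF T] by simp
  have "0 \<le> (LINT x|M. - (lam0 x * (D (S0 x) \<bullet> D (T x))))"
    by (rule integral_nonneg_AE) (use np in auto)
  moreover have "0 \<le> (LINT x|M. lam0 x * (D (S0 x) \<bullet> D (T x)))"
    using assms Xi0_inner[OF T] by (simp add: relaxed_cone_def)
  ultimately have "(LINT x|M. - (lam0 x * (D (S0 x) \<bullet> D (T x)))) = 0" by simp
  then show ?thesis
    using integral_nonneg_eq_0_iff_AE[OF int] np by auto
qed

text \<open>Directions in the kernel of \<open>D\<close> see neither the constraint nor the
  curvature. They are critical together with their negatives, which later turns inequalities over
  the cone into equations on \<open>H_set M D\<close>.\<close>

lemma H_set_cone:
  assumes h: "h \<in> H_set M D"
  shows "h \<in> relaxed_cone 0" "q h = 0" "T \<in> L2 M \<Longrightarrow> p T h = 0"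
proof -
  have L2: "h \<in> L2 M" and 0: "AE x in M. D (h x) = 0" using h by (auto simp: H_set_def)
  have [measurable]: "h \<in> borel_measurable M" using L2 by (rule L2_measurable)
  have "integrable M (\<lambda>x. lam0 x * (norm (D (h x)))\<^sup>2) \<longleftrightarrow> integrable M (\<lambda>x::'w. 0::real)"
    by (rule integrable_cong_AE) (use 0 in auto)
  then have "h \<in> Wt" using L2 by (simp add: Wt_def)
  moreover have "L2_inner M Xi0 h = 0"
    unfolding Xi0_inner[OF L2] by (rule integral_eq_zero_AE) (use 0 in auto)
  moreover have "AE x in M. norm (D (S0 x)) = 1 \<longrightarrow> D (S0 x) \<bullet> D (h x) \<le> 0"
    using 0 by eventually_elim auto
  ultimately show "h \<in> relaxed_cone 0" by (simp add: relaxed_cone_def)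
  show "q h = 0"
    unfolding q_def by (rule integral_eq_zero_AE) (use 0 in auto)
  show "p T h = 0"
    unfolding p_def by (rule integral_eq_zero_AE) (use 0 in auto)
qed

text \<open>Expanding \<open>norm (D (S0 + t T)) \<le> 1\<close> on the active set produces the curvature term.\<close>

lemma feasible_direction:
  assumes t: "t > 0" and T: "T \<in> L2 M" and K: "(\<lambda>x. S0 x + t *\<^sub>R T x) \<in> K_set M D"
  shows "T \<in> Wt" "AE x in M. norm (D (S0 x)) = 1 \<longrightarrow> D (S0 x) \<bullet> D (T x) \<le> 0"
    "L2_inner M Xi0 T \<le> - (t / 2) * q T"
proof -
  have [measurable]: "T \<in> borel_measurable M" using T by (rule L2_measurable)
  have "AE x in M. norm (D (S0 x + t *\<^sub>R T x)) \<le> 1" using K by (simp add: K_set_def)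
  then have act: "AE x in M. norm (D (S0 x)) = 1 \<longrightarrow> D (S0 x) \<bullet> D (T x) \<le> - (t / 2) * (norm (D (T x)))\<^sup>2"
  proof eventually_elim
    case (elim x)
    show ?case
    proof
      assume 1: "norm (D (S0 x)) = 1"
      have "(norm (D (S0 x) + t *\<^sub>R D (T x)))\<^sup>2 \<le> 1"
        using elim power_mono[of "norm (D (S0 x) + t *\<^sub>R D (T x))" 1 2]
        by (simp add: linear_add[OF linear_D] linear_scale[OF linear_D])
      then have "1 + 2 * t * (D (S0 x) \<bullet> D (T x)) + t\<^sup>2 * (norm (D (T x)))\<^sup>2 \<le> 1"
        using 1 dot_norm[of "D (S0 x)" "t *\<^sub>R D (T x)"] by (simp add: power_mult_distrib)
      then have "t * (2 * (D (S0 x) \<bullet> D (T x)) + t * (norm (D (T x)))\<^sup>2) \<le> 0"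
        by (simp add: power2_eq_square algebra_simps)
      then have "2 * (D (S0 x) \<bullet> D (T x)) + t * (norm (D (T x)))\<^sup>2 \<le> 0"
        using t by (simp add: mult_le_0_iff)
      then show "D (S0 x) \<bullet> D (T x) \<le> - (t / 2) * (norm (D (T x)))\<^sup>2" by simp
    qed
  qed
  then show "AE x in M. norm (D (S0 x)) = 1 \<longrightarrow> D (S0 x) \<bullet> D (T x) \<le> 0"
  proof eventually_elim
    case (elim x)
    have "- (t / 2) * (norm (D (T x)))\<^sup>2 \<le> 0" using t by simp
    with elim show ?case by (meson order_trans)
  qed
  have curv: "AE x in M. (t / 2) * (lam0 x * (norm (D (T x)))\<^sup>2) \<le> - (lam0 x * (D (S0 x) \<bullet> D (T x)))"
    using act D_S0_le lam0_zero lam0_nonneg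
  proof eventually_elim
    case (elim x)
    show ?case
    proof (cases "lam0 x = 0")
      case False
      then have "norm (D (S0 x)) = 1" using elim by force
      then have "lam0 x * (D (S0 x) \<bullet> D (T x)) \<le> lam0 x * (- (t / 2) * (norm (D (T x)))\<^sup>2)"
        using elim by (intro mult_left_mono) auto
      then show ?thesis by (simp add: algebra_simps)
    qed simp
  qed
  have int: "integrable M (\<lambda>x. - (lam0 x * (D (S0 x) \<bullet> D (T x))))"
    using Xi0_inner_integrable[OF T] by simp
  \<comment> \<open>Membership in \<open>Wt\<close> is a conclusion here: the nonnegative curvature
    integrand is dominated by the linear one, whose integrability is already known.\<close>
  have "integrable M (\<lambda>x. (t / 2) * (lam0 x * (norm (D (T x)))\<^sup>2))"
  proof (rule Bochner_Integration.integrable_bound[OF int])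
    show "AE x in M. norm (t / 2 * (lam0 x * (norm (D (T x)))\<^sup>2)) \<le> norm (- (lam0 x * (D (S0 x) \<bullet> D (T x))))"
      using curv lam0_nonneg
    proof eventually_elim
      case (elim x)
      have "0 \<le> t / 2 * (lam0 x * (norm (D (T x)))\<^sup>2)" using elim t by simp
      with elim show ?case by (simp only: real_norm_def)
    qed
  qed measurable
  then have "integrable M (\<lambda>x. (2 / t) * ((t / 2) * (lam0 x * (norm (D (T x)))\<^sup>2)))"
    by (rule integrable_mult_right)
  also have "(\<lambda>x. (2 / t) * ((t / 2) * (lam0 x * (norm (D (T x)))\<^sup>2)))
      = (\<lambda>x. lam0 x * (norm (D (T x)))\<^sup>2)"
    using t by (simp add: fun_eq_iff)
  finally have i: "integrable M (\<lambda>x. lam0 x * (norm (D (T x)))\<^sup>2)" .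
  then show "T \<in> Wt" using T by (simp add: Wt_def)
  have "(LINT x|M. (t / 2) * (lam0 x * (norm (D (T x)))\<^sup>2)) \<le> (LINT x|M. - (lam0 x * (D (S0 x) \<bullet> D (T x))))"
    by (rule integral_mono_AE) (use i int curv in auto)
  then show "L2_inner M Xi0 T \<le> - (t / 2) * q T"
    by (simp add: Xi0_inner[OF T] q_def)
qed

text \<open>
  Convexity is replaced by explicit test functionals: the truncated weights \<open>min (lam0 x) N\<close> keep
  the functional bounded although \<open>lam0\<close> need not be.
\<close>

lemma relaxed_cone_weakly_closed:
  assumes w: "L2_weakly_tendsto M Tk T" and c: "\<And>k. Tk k \<in> relaxed_cone (e k)" and e: "e \<longlonglongrightarrow> 0"
    and qb: "\<And>k. q (Tk k) \<le> c"
  shows "T \<in> relaxed_cone 0" "q T \<le> c"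
proof -
  have T: "T \<in> L2 M" using w by (simp add: L2_weakly_tendsto_def)
  have TkL2: "Tk k \<in> L2 M" for k using c by (rule relaxed_cone_L2)
  have [measurable]: "T \<in> borel_measurable M" "Tk k \<in> borel_measurable M" for k
    using T TkL2 by (auto intro: L2_measurable)
  have lim: "(\<lambda>k. L2_inner M g (Tk k)) \<longlonglongrightarrow> L2_inner M g T" if "g \<in> L2 M" for g
    using w L2_bounded_linear_inner[OF that] by (simp add: L2_weakly_tendsto_def)
  have adj: "linear (adjoint D)" by (rule adjoint_linear[OF linear_D])
  have lim_D: "(\<lambda>k. LINT x|M. g x \<bullet> D (Tk k x)) \<longlonglongrightarrow> (LINT x|M. g x \<bullet> D (T x))"
    if "g \<in> L2 M" for g
    using lim[OF L2_linear_image[OF adj that]] by (simp add: L2_inner_def adjoint_clauses[OF linear_D])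
  define E where "E = {x. norm (D (S0 x)) = 1 \<and> D (S0 x) \<bullet> D (T x) > 0}"
  have E_sets [measurable]: "Measurable.pred M (\<lambda>x. x \<in> E)" 
  proof -
    have "(\<lambda>x. x \<in> E) = (\<lambda>x. 1 \<le> norm (D (S0 x)) \<and> norm (D (S0 x)) \<le> 1 \<and> 0 < D (S0 x) \<bullet> D (T x))"
      by (auto simp: E_def fun_eq_iff)
    then show ?thesis by (simp only:) measurable
  qed
  \<comment> \<open>Tested with \<open>g\<close>, the sequence gives nonpositive integrals because
    the coefficient is positive on \<open>E\<close>, whereas \<open>T\<close> gives the integral of
    its square. Passing to the limit shows that \<open>E\<close> is negligible.\<close>
  define g where "g x = (if x \<in> E then (D (S0 x) \<bullet> D (T x)) *\<^sub>R D (S0 x) else 0)" for x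
  have g: "g \<in> L2 M"
  proof (rule L2_bound[OF D_L2[OF T], of _ 1])
    show "g \<in> borel_measurable M" unfolding g_def by measurable
    show "AE x in M. norm (g x) \<le> 1 * norm (D (T x))"
    proof (rule AE_I2)
      fix x
      show "norm (g x) \<le> 1 * norm (D (T x))"
        using Cauchy_Schwarz_ineq2[of "D (S0 x)" "D (T x)"] by (auto simp: g_def E_def)
    qed
  qed
  have le0: "(LINT x|M. g x \<bullet> D (Tk k x)) \<le> 0" for k
  proof -
    have "AE x in M. norm (D (S0 x)) = 1 \<longrightarrow> D (S0 x) \<bullet> D (Tk k x) \<le> 0"
      using c[of k] by (simp add: relaxed_cone_def)
    then have "AE x in M. g x \<bullet> D (Tk k x) \<le> 0"
      by eventually_elim (auto simp: g_def E_def mult_le_0_iff)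
    then have "0 \<le> (LINT x|M. - (g x \<bullet> D (Tk k x)))" by (intro integral_nonneg_AE) auto
    then show ?thesis by simp
  qed
  have "(LINT x|M. g x \<bullet> D (T x)) \<le> 0"
    by (rule LIMSEQ_le_const2[OF lim_D[OF g]]) (use le0 in auto)
  moreover have gpos: "0 \<le> g x \<bullet> D (T x)" for x by (simp add: g_def E_def)
  moreover have "0 \<le> (LINT x|M. g x \<bullet> D (T x))"
    by (rule integral_nonneg_AE) (simp add: gpos)
  ultimately have "(LINT x|M. g x \<bullet> D (T x)) = 0" by simp
  then have "AE x in M. g x \<bullet> D (T x) = 0"
    using integral_nonneg_eq_0_iff_AE[OF L2_integrable_inner[OF g D_L2[OF T]]] gpos by simp
  then have tang: "AE x in M. norm (D (S0 x)) = 1 \<longrightarrow> D (S0 x) \<bullet> D (T x) \<le> 0"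
    by eventually_elim (auto simp: g_def E_def split: if_splits)
  have "(\<lambda>k. - e k) \<longlonglongrightarrow> 0" using tendsto_minus[OF e] by simp
  then have xi: "0 \<le> L2_inner M Xi0 T"
    by (rule LIMSEQ_le[OF _ lim[OF Xi0_L2]]) (use c in \<open>auto simp: relaxed_cone_def\<close>)
  \<comment> \<open>\<open>lam0\<close> is nonnegative only almost everywhere; the outer
    \<open>max\<close> makes the weight nonnegative everywhere.\<close>
  define m where "m N x = max 0 (min (lam0 x) (real N))" for N x
  have [measurable]: "m N \<in> borel_measurable M" for N unfolding m_def by measurable
  have m_b: "0 \<le> m N x" "m N x \<le> real N" for N x by (auto simp: m_def)
  have m_int: "integrable M (\<lambda>x. m N x * (norm (D (S x)))\<^sup>2)" if S: "S \<in> L2 M" for N S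
  proof (rule Bochner_Integration.integrable_bound)
    have [measurable]: "S \<in> borel_measurable M" using S by (rule L2_measurable)
    show "integrable M (\<lambda>x. real N * (norm (D (S x)))\<^sup>2)"
      using L2_integrable_power2[OF D_L2[OF S]] by simp
    show "(\<lambda>x. m N x * (norm (D (S x)))\<^sup>2) \<in> borel_measurable M" by measurable
    show "AE x in M. norm (m N x * (norm (D (S x)))\<^sup>2) \<le> norm (real N * (norm (D (S x)))\<^sup>2)"
      using m_b by (simp add: abs_mult mult_right_mono)
  qed
  have trunc: "(LINT x|M. m N x * (norm (D (T x)))\<^sup>2) \<le> c" for N
  proof -
    have gN: "(\<lambda>x. m N x *\<^sub>R D (T x)) \<in> L2 M"
      by (rule L2_bound[OF D_L2[OF T], of _ "real N"]) (use m_b in \<open>auto intro!: AE_I2 mult_right_mono\<close>)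
    let ?a = "LINT x|M. m N x * (norm (D (T x)))\<^sup>2"
    \<comment> \<open>Young's inequality with equal weights: in the limit
      \<open>?a <= ?a / 2 + c / 2\<close>, hence \<open>?a <= c\<close>. One linear test thus yields
      weak lower semicontinuity.\<close>
    have "(LINT x|M. (m N x *\<^sub>R D (T x)) \<bullet> D (Tk k x)) \<le> ?a / 2 + c / 2" for k
    proof -
      have "(LINT x|M. (m N x *\<^sub>R D (T x)) \<bullet> D (Tk k x))
          \<le> (LINT x|M. (m N x * (norm (D (T x)))\<^sup>2) / 2 + (lam0 x * (norm (D (Tk k x)))\<^sup>2) / 2)"
      proof (rule integral_mono_AE)
        show "integrable M (\<lambda>x. (m N x *\<^sub>R D (T x)) \<bullet> D (Tk k x))"
          by (rule L2_integrable_inner[OF gN D_L2[OF TkL2]])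
        show "integrable M (\<lambda>x. (m N x * (norm (D (T x)))\<^sup>2) / 2 + (lam0 x * (norm (D (Tk k x)))\<^sup>2) / 2)"
          using m_int[OF T] relaxed_cone_Wt[OF c[of k]] by (simp add: Wt_def)
        show "AE x in M. (m N x *\<^sub>R D (T x)) \<bullet> D (Tk k x)
            \<le> (m N x * (norm (D (T x)))\<^sup>2) / 2 + (lam0 x * (norm (D (Tk k x)))\<^sup>2) / 2"
          using lam0_nonneg
        proof eventually_elim
          case (elim x)
          have "2 * (D (T x) \<bullet> D (Tk k x)) \<le> 2 * (norm (D (T x)) * norm (D (Tk k x)))"
            using norm_cauchy_schwarz[of "D (T x)" "D (Tk k x)"] by simp
          also have "\<dots> \<le> (norm (D (T x)))\<^sup>2 + (norm (D (Tk k x)))\<^sup>2"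
            using sum_squares_bound[of "norm (D (T x))" "norm (D (Tk k x))"] by simp
          finally have "m N x * (2 * (D (T x) \<bullet> D (Tk k x))) \<le> m N x * ((norm (D (T x)))\<^sup>2 + (norm (D (Tk k x)))\<^sup>2)"
            using m_b by (intro mult_left_mono)
          moreover have "m N x * (norm (D (Tk k x)))\<^sup>2 \<le> lam0 x * (norm (D (Tk k x)))\<^sup>2"
            using elim by (intro mult_right_mono) (auto simp: m_def)
          ultimately show ?case by (simp add: distrib_left)
        qed
      qed
      also have "\<dots> = ?a / 2 + q (Tk k) / 2"
        using m_int[OF T] relaxed_cone_Wt[OF c[of k]] by (simp add: Wt_def q_def)
      also have "\<dots> \<le> ?a / 2 + c / 2" using qb[of k] by simp
      finally show ?thesis .
    qed
    then have "(LINT x|M. (m N x *\<^sub>R D (T x)) \<bullet> D (T x)) \<le> ?a / 2 + c / 2"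
      by (intro LIMSEQ_le_const2[OF lim_D[OF gN]]) auto
    moreover have "(LINT x|M. (m N x *\<^sub>R D (T x)) \<bullet> D (T x)) = ?a"
      by (simp add: power2_norm_eq_inner)
    ultimately show ?thesis by simp
  qed
  have mlim: "AE x in M. (\<lambda>N. m N x * (norm (D (T x)))\<^sup>2) \<longlonglongrightarrow> lam0 x * (norm (D (T x)))\<^sup>2"
    using lam0_nonneg
  proof eventually_elim
    case (elim x)
    obtain N0 where N0: "lam0 x \<le> real N0" using real_arch_simple by blast
    have "m N x = lam0 x" if "N \<ge> N0" for N
      using that N0 elim by (simp add: m_def)
    then have "\<forall>\<^sub>F N in sequentially. m N x * (norm (D (T x)))\<^sup>2 = lam0 x * (norm (D (T x)))\<^sup>2"
      by (auto simp: eventually_sequentially)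
    then show ?case by (rule tendsto_eventually)
  qed
  \<comment> \<open>The bound \<open>c\<close> is independent of the truncation level, so it
    survives \<open>N\<close> tending to infinity and makes the untruncated integrand
    integrable.\<close>
  note F = Fatou_integrable[OF m_int[OF T] _ mlim _ trunc]
  have "T \<in> Wt" using F(1) T m_b by (simp add: Wt_def)
  with tang xi show "T \<in> relaxed_cone 0" by (simp add: relaxed_cone_def)
  show "q T \<le> c" unfolding q_def using F(2) m_b by simp
qed


text \<open>
  Rescaling \<open>S0 + t R\<close> to unit size on the complement of the kernel of \<open>D\<close> makes it feasible; the
  kernel component must be left alone since \<open>S0\<close> is bounded only modulo that kernel.
\<close>

lemma recovery_family:
  assumes R: "R \<in> relaxed_cone 0"
  shows "\<exists>Rt. (\<forall>t. Rt t \<in> L2 M) \<and>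
    (\<forall>t>0. (\<lambda>x. S0 x + t *\<^sub>R Rt t x) \<in> K_set M D \<and> - L2_inner M Xi0 (Rt t) \<le> t / 2 * q R) \<and>
    ((\<lambda>t. L2_norm M (\<lambda>x. Rt t x - R x)) \<longlongrightarrow> 0) (at_right 0)"
proof -
  have RL2: "R \<in> L2 M" using R by (rule relaxed_cone_L2)
  have [measurable]: "R \<in> borel_measurable M" using RL2 by (rule L2_measurable)
  \<comment> \<open>A linear section of \<open>D\<close> over its range: subtracting a multiple of
    \<open>g (D y)\<close> from \<open>y\<close> rescales \<open>D y\<close> and changes nothing
    else.\<close>
  obtain g :: "'d \<Rightarrow> 'b" where g: "linear g" "\<And>y. D (g (D y)) = D y"
    using linear_exists_right_inverse_on[OF linear_D subspace_UNIV] by auto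
  then have bg: "bounded_linear g" by (simp add: linear_conv_bounded_linear)
  obtain c where c: "c > 0" "\<And>y. norm (g y) \<le> norm y * c"
    using bounded_linear.pos_bounded[OF bg] by blast
  have [measurable]: "g \<in> borel_measurable borel"
    using bg by (simp add: borel_measurable_continuous_onI linear_continuous_on)
  define N where "N t x = norm (D (S0 x + t *\<^sub>R R x))" for t x
  define s where "s t x = 1 - 1 / max 1 (N t x)" for t x
  \<comment> \<open>For \<open>t <= 0\<close> the value \<open>R\<close> is a default that keeps
    \<open>Rt t\<close> in \<open>L2 M\<close> for every \<open>t\<close>.\<close>
  define Rt where "Rt t x = (if t > 0 then R x - (s t x / t) *\<^sub>R g (D (S0 x + t *\<^sub>R R x)) else R x)" for t x
  have [measurable]: "N t \<in> borel_measurable M" for t unfolding N_def by measurable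
  have [measurable]: "s t \<in> borel_measurable M" for t unfolding s_def by measurable
  have [measurable]: "Rt t \<in> borel_measurable M" for t
    by (cases "t > 0") (simp_all add: Rt_def[abs_def])
  have N0: "0 \<le> N t x" for t x by (simp add: N_def)
  have s0: "0 \<le> s t x" for t x by (simp add: s_def)
  have sN: "s t x * N t x = max 0 (N t x - 1)" for t x
    using N0[of t x] by (auto simp: s_def max_def field_simps)
  have DR: "D (Rt t x) = D (R x) - (s t x / t) *\<^sub>R D (S0 x + t *\<^sub>R R x)" if "t > 0" for t x
    using that by (simp add: Rt_def linear_diff[OF linear_D] linear_scale[OF linear_D] g(2))
  have dist: "norm (Rt t x - R x) \<le> c * (max 0 (N t x - 1) / t)" if t: "t > 0" for t x
  proof -
    have "norm (Rt t x - R x) = s t x / t * norm (g (D (S0 x + t *\<^sub>R R x)))"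
      using t s0 by (simp add: Rt_def)
    also have "\<dots> \<le> s t x / t * (N t x * c)"
      unfolding N_def using t s0 c by (intro mult_left_mono) auto
    also have "\<dots> = c * (s t x * N t x / t)" by simp
    finally show ?thesis by (simp only: sN)
  qed
  \<comment> \<open>Feasibility of \<open>S0\<close> limits the overshoot to
    \<open>t * norm (D (R x))\<close>. This majorant, free of \<open>t\<close> after division,
    serves both square-integrability and dominated convergence.\<close>
  have Nle: "AE x in M. \<forall>t>0. max 0 (N t x - 1) / t \<le> norm (D (R x))"
    using D_S0_le
  proof eventually_elim
    case (elim x)
    show ?case
    proof (intro allI impI)
      fix t :: real assume t: "t > 0"
      have "N t x \<le> norm (D (S0 x)) + norm (t *\<^sub>R D (R x))"
        unfolding N_def linear_add[OF linear_D] linear_scale[OF linear_D] by (rule norm_triangle_ineq)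
      then have "N t x - 1 \<le> t * norm (D (R x))" using elim t by simp
      moreover have "0 \<le> t * norm (D (R x))" using t by simp
      ultimately show "max 0 (N t x - 1) / t \<le> norm (D (R x))" using t by (simp add: field_simps)
    qed
  qed
  have Nsq: "(N t x)\<^sup>2 = (norm (D (S0 x)))\<^sup>2 + 2 * t * (D (S0 x) \<bullet> D (R x)) + t\<^sup>2 * (norm (D (R x)))\<^sup>2" for t x
    unfolding N_def using dot_norm[of "D (S0 x)" "t *\<^sub>R D (R x)"]
    by (simp add: linear_add[OF linear_D] linear_scale[OF linear_D] power_mult_distrib)
  have diffL2: "(\<lambda>x. Rt t x - R x) \<in> L2 M" for t
  proof (cases "t > 0")
    case True
    show ?thesis
    proof (rule L2_bound[OF D_L2[OF RL2]])
      show "AE x in M. norm (Rt t x - R x) \<le> c * norm (D (R x))"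
        using Nle
      proof eventually_elim
        case (elim x)
        have "c * (max 0 (N t x - 1) / t) \<le> c * norm (D (R x))"
          using elim True c(1) by (intro mult_left_mono) auto
        with dist[OF True, of x] show ?case by linarith
      qed
    qed measurable
  next
    case False
    then show ?thesis by (simp add: Rt_def)
  qed
  have RtL2: "Rt t \<in> L2 M" for t
    using L2_add[OF RL2 diffL2[of t]] by simp
  have K: "(\<lambda>x. S0 x + t *\<^sub>R Rt t x) \<in> K_set M D" if t: "t > 0" for t
  proof -
    have "norm (D (S0 x + t *\<^sub>R Rt t x)) \<le> 1" for x
    proof -
      have "D (S0 x + t *\<^sub>R Rt t x) = (1 - s t x) *\<^sub>R D (S0 x + t *\<^sub>R R x)"
        using t by (simp add: linear_add[OF linear_D] linear_scale[OF linear_D] DR[OF t] algebra_simps)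
      then have "norm (D (S0 x + t *\<^sub>R Rt t x)) = N t x / max 1 (N t x)"
        by (simp add: N_def s_def)
      then show ?thesis by (simp add: max_def)
    qed
    moreover have "(\<lambda>x. S0 x + t *\<^sub>R Rt t x) \<in> L2 M"
      using RtL2 by (intro L2_add L2_scaleR Sig_L2)
    ultimately show ?thesis by (simp add: K_set_def)
  qed
  \<comment> \<open>Where \<open>lam0\<close> is nonzero, criticality makes \<open>D R\<close>
    orthogonal to \<open>D S0\<close>, so the overshoot is of second order: \<open>s\<close> is at
    most \<open>((N t x)^2 - 1) / 2\<close>, which equals
    \<open>t^2 * (norm (D (R x)))^2 / 2\<close>. Division by \<open>t\<close> and weighting by
    \<open>lam0\<close> give the claim.\<close>
  have energy: "- L2_inner M Xi0 (Rt t) \<le> t / 2 * q R" if t: "t > 0" for t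
  proof -
    have "(LINT x|M. - (lam0 x * (D (S0 x) \<bullet> D (Rt t x)))) \<le> (LINT x|M. t / 2 * (lam0 x * (norm (D (R x)))\<^sup>2))"
    proof (rule integral_mono_AE)
      show "integrable M (\<lambda>x. - (lam0 x * (D (S0 x) \<bullet> D (Rt t x))))"
        using Xi0_inner_integrable[OF RtL2[of t]] by simp
      show "integrable M (\<lambda>x. t / 2 * (lam0 x * (norm (D (R x)))\<^sup>2))"
        using relaxed_cone_Wt[OF R] by (simp add: Wt_def)
      show "AE x in M. - (lam0 x * (D (S0 x) \<bullet> D (Rt t x))) \<le> t / 2 * (lam0 x * (norm (D (R x)))\<^sup>2)"
        using relaxed_cone_0_complementary[OF R] D_S0_le lam0_zero lam0_nonneg
      proof eventually_elim
        case (elim x)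
        show ?case
        proof (cases "lam0 x = 0")
          case False
          then have 1: "norm (D (S0 x)) = 1" and 0: "D (S0 x) \<bullet> D (R x) = 0" using elim by force+
          have 11: "D (S0 x) \<bullet> D (S0 x) = 1" using 1 by (simp add: norm_eq_1)
          have n2: "(N t x)\<^sup>2 = 1 + t\<^sup>2 * (norm (D (R x)))\<^sup>2" using Nsq[of t x] 0 1 by simp
          then have "1 \<le> (N t x)\<^sup>2" by simp
          then have n1: "1 \<le> N t x" using power2_le_imp_le[of 1 "N t x"] N0[of t x] by simp
          have "D (S0 x) \<bullet> D (Rt t x) = - (s t x / t)"
            using 0 11 by (simp add: DR[OF t] linear_add[OF linear_D] linear_scale[OF linear_D]
                inner_diff_right inner_add_right)
          moreover have "s t x \<le> t\<^sup>2 * (norm (D (R x)))\<^sup>2 / 2"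
          proof -
            have "s t x \<le> s t x * N t x" using n1 s0[of t x] by (simp add: mult_le_cancel_left1)
            also have "\<dots> = N t x - 1" using n1 by (simp add: sN)
            also have "\<dots> \<le> ((N t x)\<^sup>2 - 1) / 2"
              using zero_le_power2[of "N t x - 1"] by (simp add: power2_diff)
            finally show ?thesis by (simp add: n2)
          qed
          then have "s t x / t \<le> t / 2 * (norm (D (R x)))\<^sup>2"
            using t by (simp add: field_simps power2_eq_square)
          ultimately have "- (D (S0 x) \<bullet> D (Rt t x)) \<le> t / 2 * (norm (D (R x)))\<^sup>2" by simp
          then have "lam0 x * - (D (S0 x) \<bullet> D (Rt t x)) \<le> lam0 x * (t / 2 * (norm (D (R x)))\<^sup>2)"
            using elim by (intro mult_left_mono) auto
          then show ?thesis by (simp add: mult_ac)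
        qed simp
      qed
    qed
    then show ?thesis by (simp add: Xi0_inner[OF RtL2] q_def)
  qed
  have lim: "((\<lambda>t. L2_norm M (\<lambda>x. Rt t x - R x)) \<longlongrightarrow> 0) (at_right 0)"
    unfolding tendsto_at_iff_sequentially
  proof (intro allI impI)
    fix X :: "nat \<Rightarrow> real" assume X: "\<forall>i. X i \<in> {0<..} - {0}" and X0: "X \<longlonglongrightarrow> 0"
    have Xpos: "X i > 0" for i using X by auto
    \<comment> \<open>On the active set tangency leaves an overshoot of order \<open>t^2\<close>;
      elsewhere the strict inequality persists for small \<open>t\<close>, with a threshold
      depending on \<open>x\<close>.\<close>
    have "AE x in M. (\<lambda>i. max 0 (N (X i) x - 1) / X i) \<longlonglongrightarrow> 0"
      using D_S0_le R[unfolded relaxed_cone_def, simplified, THEN conjunct2, THEN conjunct1]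
    proof eventually_elim
      case (elim x)
      show ?case
      proof (cases "norm (D (S0 x)) = 1")
        case True
        have "max 0 (N (X i) x - 1) / X i \<le> X i * ((norm (D (R x)))\<^sup>2 / 2)" for i
        proof -
          have "X i * (D (S0 x) \<bullet> D (R x)) \<le> 0"
            using True elim(2) Xpos[of i] by (simp add: mult_le_0_iff)
          then have "(N (X i) x)\<^sup>2 \<le> 1 + (X i)\<^sup>2 * (norm (D (R x)))\<^sup>2"
            using Nsq[of "X i" x] True by simp
          moreover have "N (X i) x - 1 \<le> ((N (X i) x)\<^sup>2 - 1) / 2"
            using zero_le_power2[of "N (X i) x - 1"] by (simp add: power2_diff)
          ultimately have "N (X i) x - 1 \<le> (X i)\<^sup>2 * (norm (D (R x)))\<^sup>2 / 2" by simp
          then have "max 0 (N (X i) x - 1) \<le> (X i)\<^sup>2 * (norm (D (R x)))\<^sup>2 / 2"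
            unfolding max_def by (cases "0 \<le> N (X i) x - 1") simp_all
          then have "max 0 (N (X i) x - 1) / X i \<le> ((X i)\<^sup>2 * (norm (D (R x)))\<^sup>2 / 2) / X i"
            using Xpos[of i] by (intro divide_right_mono) auto
          then show ?thesis using Xpos[of i] by (simp add: power2_eq_square)
        qed
        moreover have "0 \<le> max 0 (N (X i) x - 1) / X i" for i using Xpos[of i] by simp
        ultimately have "norm (max 0 (N (X i) x - 1) / X i) \<le> X i * ((norm (D (R x)))\<^sup>2 / 2)" for i
          by (simp only: real_norm_def abs_of_nonneg)
        moreover have "(\<lambda>i. X i * ((norm (D (R x)))\<^sup>2 / 2)) \<longlonglongrightarrow> 0"
          using tendsto_mult_right[OF X0, of "(norm (D (R x)))\<^sup>2 / 2"] by simp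
        ultimately show ?thesis
          by (rule Lim_null_comparison[OF always_eventually[OF allI]])
      next
        case False
        have "(\<lambda>i. N (X i) x) \<longlonglongrightarrow> norm (D (S0 x) + 0 *\<^sub>R D (R x))"
          unfolding N_def linear_add[OF linear_D] linear_scale[OF linear_D] by (intro tendsto_intros X0)
        moreover have "norm (D (S0 x) + 0 *\<^sub>R D (R x)) < 1" using False elim(1) by simp
        ultimately have "\<forall>\<^sub>F i in sequentially. N (X i) x < 1" by (rule order_tendstoD(2))
        then have "\<forall>\<^sub>F i in sequentially. max 0 (N (X i) x - 1) / X i = 0"
          by eventually_elim simp
        then show ?thesis by (rule tendsto_eventually)
      qed
    qed
    then have pt: "AE x in M. (\<lambda>i. (norm (Rt (X i) x - R x))\<^sup>2) \<longlonglongrightarrow> 0"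
    proof eventually_elim
      case (elim x)
      have "(\<lambda>i. norm (Rt (X i) x - R x)) \<longlonglongrightarrow> 0"
      proof (rule Lim_null_comparison[OF always_eventually[OF allI]])
        show "(\<lambda>i. c * (max 0 (N (X i) x - 1) / X i)) \<longlonglongrightarrow> 0"
          using tendsto_mult_left[OF elim, of c] by simp
        show "norm (norm (Rt (X i) x - R x)) \<le> c * (max 0 (N (X i) x - 1) / X i)" for i
          using dist[OF Xpos, of i x] by (simp only: real_norm_def abs_norm_cancel)
      qed
      from tendsto_power[OF this, of 2] show ?case by simp
    qed
    have "(\<lambda>i. LINT x|M. (norm (Rt (X i) x - R x))\<^sup>2) \<longlonglongrightarrow> (LINT x|M. (0::real))"
    proof (rule integral_dominated_convergence)
      show "integrable M (\<lambda>x. c\<^sup>2 * (norm (D (R x)))\<^sup>2)"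
        using L2_integrable_power2[OF D_L2[OF RL2]] by simp
      show "AE x in M. norm ((norm (Rt (X i) x - R x))\<^sup>2) \<le> c\<^sup>2 * (norm (D (R x)))\<^sup>2" for i
        using Nle
      proof eventually_elim
        case (elim x)
        have "c * (max 0 (N (X i) x - 1) / X i) \<le> c * norm (D (R x))"
          using elim Xpos[of i] c(1) by (intro mult_left_mono) auto
        then have "norm (Rt (X i) x - R x) \<le> c * norm (D (R x))"
          using dist[OF Xpos[of i], of x] by linarith
        from power_mono[OF this, of 2] show ?case by (simp add: power_mult_distrib)
      qed
    qed (use pt in auto)
    then have "(\<lambda>i. sqrt ((L2_norm M (\<lambda>x. Rt (X i) x - R x))\<^sup>2)) \<longlonglongrightarrow> sqrt 0"
      unfolding L2_norm_power2 by (intro tendsto_real_sqrt) simp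
    then show "((\<lambda>t. L2_norm M (\<lambda>x. Rt t x - R x)) \<circ> X) \<longlonglongrightarrow> 0"
      by (simp add: comp_def)
  qed
  show ?thesis using RtL2 K energy lim by (intro exI[of _ Rt]) blast
qed

section \<open>The domain of the second subderivative\<close>

text \<open>Feasibility bounds the pairing with \<open>Xi0\<close> above by
  \<open>- (t / 2) * q T\<close> and the hypothesis bounds it below by \<open>- (t / 2) * c\<close>;
  comparing the two bounds the curvature.\<close>

lemma feasible_cone_bounds:
  assumes t: "t > 0" and T: "T \<in> L2 M" and K: "(\<lambda>x. S0 x + t *\<^sub>R T x) \<in> K_set M D"
    and c: "- L2_inner M Xi0 T \<le> t / 2 * c"
  shows "T \<in> relaxed_cone (t / 2 * c)" "q T \<le> c"
proof -
  note F = feasible_direction[OF t T K]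
  show "T \<in> relaxed_cone (t / 2 * c)" using F c by (simp add: relaxed_cone_def)
  have "t / 2 * q T \<le> t / 2 * c" using F(3) c by simp
  then show "q T \<le> c" using t by (simp add: mult_le_cancel_left)
qed

text \<open>A finite value supplies a weakly convergent sequence that satisfies the hypotheses of
  \<open>feasible_cone_bounds\<close> along a subsequence, and weak closedness concludes.
  Conversely, the quotients along a recovery family stay below \<open>q T\<close>.\<close>

lemma reduced_critical_cone_eq:
  "reduced_critical_cone M (indicator_fun (K_set M D)) S0 Xi0 = relaxed_cone 0"
proof (intro set_eqI iffI)
  let ?I = "indicator_fun (K_set M D)"
  have S0K: "?I S0 = 0" using solves_VI_K[OF VI] by (simp add: indicator_fun_def)
  fix T
  let ?Q = "\<lambda>t Tk k. (?I (\<lambda>x. S0 x + t k *\<^sub>R Tk k x) - ?I S0 - ereal (t k * L2_inner M Xi0 (Tk k)))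
                      / ereal ((t k)\<^sup>2 / 2)"
  {
    assume "T \<in> reduced_critical_cone M ?I S0 Xi0"
    then have "second_subderivative M ?I S0 Xi0 T < \<infinity>" by (simp add: reduced_critical_cone_def)
    then obtain t Tk where t: "\<And>k. t k > 0" "t \<longlonglongrightarrow> 0" and w: "L2_weakly_tendsto M Tk T"
      and lim: "liminf (?Q t Tk) < \<infinity>"
      unfolding second_subderivative_def Inf_less_iff by blast
    \<comment> \<open>Any real number above the lower limit. The quotients fall below it infinitely
      often, which gives the subsequence \<open>r\<close>; being below a real number excludes the
      value infinity and thus forces feasibility.\<close>
    obtain c where c: "liminf (?Q t Tk) < ereal c"
      using lim ereal_dense2 by blast
    have "\<not> (\<forall>\<^sub>F k in sequentially. ereal c \<le> ?Q t Tk k)"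
      using c Liminf_bounded[of "ereal c" "?Q t Tk" sequentially] by auto
    from not_eventually_sequentiallyD[OF this] obtain r :: "nat \<Rightarrow> nat"
      where r': "strict_mono r \<and> (\<forall>n. \<not> ereal c \<le> ?Q t Tk (r n))" by (rule exE)
    have r: "strict_mono r" using r' by (rule conjunct1)
    have rQ: "?Q t Tk (r n) < ereal c" for n
      by (rule not_le_imp_less) (rule spec[OF conjunct2[OF r']])
    have L2: "Tk k \<in> L2 M" for k using w by (simp add: L2_weakly_tendsto_def)
    have K: "(\<lambda>x. S0 x + t (r n) *\<^sub>R Tk (r n) x) \<in> K_set M D"
      and b: "- L2_inner M Xi0 (Tk (r n)) \<le> t (r n) / 2 * c" for n
    proof -
      show "(\<lambda>x. S0 x + t (r n) *\<^sub>R Tk (r n) x) \<in> K_set M D"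
      proof (rule ccontr)
        assume "\<not> ?thesis"
        with rQ[of n] S0K t(1)[of "r n"] show False by (simp add: indicator_fun_def)
      qed
      with rQ[of n] S0K t(1)[of "r n"]
      have "- (t (r n) * L2_inner M Xi0 (Tk (r n))) / ((t (r n))\<^sup>2 / 2) < c"
        by (simp add: indicator_fun_def)
      then show "- L2_inner M Xi0 (Tk (r n)) \<le> t (r n) / 2 * c"
        using t(1)[of "r n"] by (simp add: field_simps power2_eq_square)
    qed
    have tr: "(\<lambda>n. t (r n)) \<longlonglongrightarrow> 0"
      using LIMSEQ_subseq_LIMSEQ[OF t(2) r] by (simp add: comp_def)
    show "T \<in> relaxed_cone 0"
    proof (rule relaxed_cone_weakly_closed(1))
      show "L2_weakly_tendsto M (\<lambda>n. Tk (r n)) T"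
        unfolding L2_weakly_tendsto_def
      proof (intro conjI allI impI)
        fix F :: "('w \<Rightarrow> 'b) \<Rightarrow> real" assume "L2_bounded_linear M F"
        then have "(\<lambda>k. F (Tk k)) \<longlonglongrightarrow> F T" using w by (simp add: L2_weakly_tendsto_def)
        from LIMSEQ_subseq_LIMSEQ[OF this r] show "(\<lambda>n. F (Tk (r n))) \<longlonglongrightarrow> F T"
          by (simp add: comp_def)
      qed (use w in \<open>simp_all add: L2_weakly_tendsto_def\<close>)
      show "Tk (r n) \<in> relaxed_cone (t (r n) / 2 * c)" "q (Tk (r n)) \<le> c" for n
        using feasible_cone_bounds[OF t(1) L2 K b] by auto
      show "(\<lambda>n. t (r n) / 2 * c) \<longlonglongrightarrow> 0"
        using tendsto_mult_right[OF tr, of "c / 2"] by simp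
    qed
  next
    assume T: "T \<in> relaxed_cone 0"
    obtain Rt where Rt: "\<And>t. Rt t \<in> L2 M" "\<And>t. t > 0 \<Longrightarrow> (\<lambda>x. S0 x + t *\<^sub>R Rt t x) \<in> K_set M D"
      "\<And>t. t > 0 \<Longrightarrow> - L2_inner M Xi0 (Rt t) \<le> t / 2 * q T"
      "((\<lambda>t. L2_norm M (\<lambda>x. Rt t x - T x)) \<longlongrightarrow> 0) (at_right 0)"
      using recovery_family[OF T] by blast
    define t where "t k = inverse (real (Suc k))" for k
    have t: "t k > 0" for k by (simp add: t_def)
    have t0: "t \<longlonglongrightarrow> 0" unfolding t_def by (rule LIMSEQ_inverse_real_of_nat)
    then have "filterlim t (at_right 0) sequentially"
      using t by (intro tendsto_imp_filterlim_at_right) auto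
    then have "(\<lambda>k. L2_norm M (\<lambda>x. Rt (t k) x - T x)) \<longlonglongrightarrow> 0"
      by (rule filterlim_compose[OF Rt(4)])
    then have w: "L2_weakly_tendsto M (\<lambda>k. Rt (t k)) T"
      using Rt(1) relaxed_cone_L2[OF T] by (intro L2_strong_imp_weakly_tendsto)
    have "?Q t (\<lambda>k. Rt (t k)) k \<le> ereal (q T)" for k
    proof -
      have "- (t k * L2_inner M Xi0 (Rt (t k))) / ((t k)\<^sup>2 / 2) \<le> q T"
        using Rt(3)[OF t, of k] t[of k] by (simp add: field_simps power2_eq_square)
      then show ?thesis using Rt(2)[OF t, of k] S0K t[of k] by (simp add: indicator_fun_def)
    qed
    then have "liminf (?Q t (\<lambda>k. Rt (t k))) \<le> ereal (q T)"
      using Liminf_le[of sequentially "?Q t (\<lambda>k. Rt (t k))"] by simp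
    moreover have "second_subderivative M ?I S0 Xi0 T \<le> liminf (?Q t (\<lambda>k. Rt (t k)))"
      unfolding second_subderivative_def
    proof (rule Inf_lower, rule CollectI, rule exI[of _ t], rule exI[of _ "\<lambda>k. Rt (t k)"], rule conjI)
      show "(\<forall>k. 0 < t k) \<and> t \<longlonglongrightarrow> 0 \<and> L2_weakly_tendsto M (\<lambda>k. Rt (t k)) T"
        using t t0 w by simp
    qed (rule refl)
    ultimately have "second_subderivative M ?I S0 Xi0 T \<le> ereal (q T)"
      by (rule order_trans[rotated])
    then have "second_subderivative M ?I S0 Xi0 T < \<infinity>"
      by (rule order.strict_trans1) simp
    then show "T \<in> reduced_critical_cone M ?I S0 Xi0"
      using relaxed_cone_L2[OF T] by (simp add: reduced_critical_cone_def)
  }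
qed


subsection \<open>Difference quotients\<close>

definition DQ :: "('v \<Rightarrow>\<^sub>L real) \<Rightarrow> real \<Rightarrow> 'w \<Rightarrow> 'b" where
  "DQ dl t x = (Sig (l0 + t *\<^sub>R dl) x - S0 x) /\<^sub>R t"

definition dw :: "('v \<Rightarrow>\<^sub>L real) \<Rightarrow> real \<Rightarrow> 'v" where
  "dw dl t = (u (l0 + t *\<^sub>R dl) - u l0) /\<^sub>R t"

lemma DQ_L2 [simp]: "DQ dl t \<in> L2 M"
  unfolding DQ_def[abs_def] by (intro L2_scaleR L2_diff Sig_L2)

lemma Sig_DQ: "t > 0 \<Longrightarrow> Sig (l0 + t *\<^sub>R dl) = (\<lambda>x. S0 x + t *\<^sub>R DQ dl t x)"
  by (simp add: DQ_def fun_eq_iff)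

lemma DQ_feasible: "t > 0 \<Longrightarrow> (\<lambda>x. S0 x + t *\<^sub>R DQ dl t x) \<in> K_set M D"
  using solves_VI_K[OF VI, of "l0 + t *\<^sub>R dl"] by (simp add: Sig_DQ)

lemma B_DQ:
  assumes "t > 0"
  shows "B (DQ dl t) = dl"
proof -
  have "B (DQ dl t) = inverse t *\<^sub>R (B (Sig (l0 + t *\<^sub>R dl)) - B S0)"
    unfolding DQ_def[abs_def] by (simp add: B_scaleR B_diff L2_diff)
  also have "\<dots> = dl"
    using solves_VI_B[OF VI, of "l0 + t *\<^sub>R dl"] solves_VI_B[OF VI, of l0] assms by simp
  finally show ?thesis .
qed

lemma DQ_H:
  assumes "t > 0" "h \<in> H_set M D"
  shows "A (DQ dl t) h = - blinfun_apply (B h) (dw dl t)"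
  using solves_VI_H[OF VI assms(2), of "l0 + t *\<^sub>R dl"] solves_VI_H[OF VI assms(2), of l0] H_set_L2[OF assms(2)]
  unfolding DQ_def[abs_def] dw_def
  by (simp add: A_scaleR_left A_diff_left L2_diff blinfun.scaleR_right blinfun.diff_right
      right_diff_distrib)

text \<open>The inequality at \<open>l0 + t *\<^sub>R dl\<close>, tested with
  \<open>S0 + t R\<close> and divided twice by \<open>t\<close>. The terms in \<open>S0\<close> and
  \<open>u l0\<close> combine to the pairing with \<open>Xi0\<close>, which need not vanish and so
  retains the factor \<open>1 / t\<close>.\<close>

lemma DQ_VI:
  assumes t: "t > 0" and R: "R \<in> L2 M" and K: "(\<lambda>x. S0 x + t *\<^sub>R R x) \<in> K_set M D"
  shows "A (DQ dl t) (\<lambda>x. R x - DQ dl t x) - L2_inner M Xi0 (\<lambda>x. R x - DQ dl t x) / t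
     + blinfun_apply (B (\<lambda>x. R x - DQ dl t x)) (dw dl t) \<ge> 0"
proof -
  let ?S = "Sig (l0 + t *\<^sub>R dl)" and ?u = "u (l0 + t *\<^sub>R dl)" and ?d = "\<lambda>x. R x - DQ dl t x"
  have d: "?d \<in> L2 M" using R by auto
  have e: "(\<lambda>x. (S0 x + t *\<^sub>R R x) - ?S x) = (\<lambda>x. t *\<^sub>R ?d x)"
    by (simp add: Sig_DQ[OF t] algebra_simps)
  have uw: "?u = u l0 + t *\<^sub>R dw dl t" using t by (simp add: dw_def)
  have "A ?S (\<lambda>x. t *\<^sub>R ?d x) + blinfun_apply (B (\<lambda>x. t *\<^sub>R ?d x)) ?u \<ge> 0"
    using solves_VI_ineq[OF VI K, of "l0 + t *\<^sub>R dl"] by (simp only: e)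
  then have "t * (A ?S ?d + blinfun_apply (B ?d) ?u) \<ge> 0"
    using d by (simp add: A_scaleR_right B_scaleR blinfun.scaleR_left distrib_left)
  then have "A ?S ?d + blinfun_apply (B ?d) ?u \<ge> 0" using t by (simp add: zero_le_mult_iff)
  moreover have "A ?S ?d = A S0 ?d + t * A (DQ dl t) ?d"
    using d by (simp add: Sig_DQ[OF t] A_add_left A_scaleR_left L2_scaleR)
  moreover have "A S0 ?d = - L2_inner M Xi0 ?d - blinfun_apply (B ?d) (u l0)"
    using Xi0_eq[OF d] by (simp add: B_star_def)
  moreover have "blinfun_apply (B ?d) ?u = blinfun_apply (B ?d) (u l0) + t * blinfun_apply (B ?d) (dw dl t)"
    by (simp add: uw blinfun.add_right blinfun.scaleR_right)
  ultimately have "0 \<le> t * (A (DQ dl t) ?d - L2_inner M Xi0 ?d / t + blinfun_apply (B ?d) (dw dl t))"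
    using t by (simp add: algebra_simps)
  then show ?thesis using t by (simp add: zero_le_mult_iff)
qed

text \<open>The inequality bounds the singular pairing of \<open>Xi0\<close> with the quotient from
  below, and \<open>feasible_cone_bounds\<close> trades that pairing for the curvature of the
  quotient; \<open>c\<close> plays the curvature of the competitor \<open>R\<close>. The second
  claim keeps the pairing bound that places the quotient in a relaxed cone.\<close>

lemma DQ_energy_ineq:
  assumes t: "t > 0" and R: "R \<in> L2 M" and K: "(\<lambda>x. S0 x + t *\<^sub>R R x) \<in> K_set M D"
    and c: "- L2_inner M Xi0 R \<le> t / 2 * c"
  shows "q (DQ dl t) \<le> 2 * (A (DQ dl t) R - A (DQ dl t) (DQ dl t)) + c
     + 2 * (blinfun_apply (B R) (dw dl t) - blinfun_apply dl (dw dl t))"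
    and "- L2_inner M Xi0 (DQ dl t) \<le> t / 2 * (2 * (A (DQ dl t) R - A (DQ dl t) (DQ dl t)) + c
     + 2 * (blinfun_apply (B R) (dw dl t) - blinfun_apply dl (dw dl t)))"
proof -
  let ?T = "DQ dl t" and ?w = "dw dl t"
  let ?r = "2 * (A ?T R - A ?T ?T) + c + 2 * (blinfun_apply (B R) ?w - blinfun_apply dl ?w)"
  have 1: "0 \<le> A ?T R - A ?T ?T - (L2_inner M Xi0 R - L2_inner M Xi0 ?T) / t
     + (blinfun_apply (B R) ?w - blinfun_apply dl ?w)"
    using DQ_VI[OF t R K, of dl] R
    by (simp add: A_diff_right B_diff B_DQ[OF t] L2_inner_diff_right Xi0_L2 blinfun.diff_left)
  have "- (L2_inner M Xi0 R / t) \<le> c / 2" using c t by (simp add: field_simps)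
  with 1[unfolded diff_divide_distrib] have "- (L2_inner M Xi0 ?T / t) \<le> ?r / 2" by argo
  then show 2: "- L2_inner M Xi0 ?T \<le> t / 2 * ?r" using t by (simp add: field_simps)
  show "q ?T \<le> ?r"
    by (rule feasible_cone_bounds(2)[OF t DQ_L2 DQ_feasible[OF t] 2])
qed

text \<open>The competitor is the zero direction, feasible because \<open>S0\<close> is. Up to a
  nonpositive term, only the value of \<open>dl\<close> at \<open>dw dl t\<close> remains, which
  Lipschitz continuity bounds.\<close>

lemma DQ_bounds:
  "\<exists>c\<ge>0. \<forall>t>0. DQ dl t \<in> relaxed_cone (t / 2 * c) \<and> q (DQ dl t) \<le> c \<and> norm (dw dl t) \<le> c"
proof -
  obtain L where L: "L > 0"
    "\<And>l\<^sub>1 l\<^sub>2 S\<^sub>1 S\<^sub>2 u\<^sub>1 u\<^sub>2. solves_VI M A B D l\<^sub>1 (S\<^sub>1, u\<^sub>1) \<Longrightarrow> solves_VI M A B D l\<^sub>2 (S\<^sub>2, u\<^sub>2) \<Longrightarrow>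
       norm (u\<^sub>1 - u\<^sub>2) \<le> L * norm (l\<^sub>1 - l\<^sub>2)"
    using solution_Lipschitz by blast
  \<comment> \<open>The first summand bounds twice that value; the second is added so that the same
    number also bounds \<open>dw dl t\<close>.\<close>
  define c where "c = 2 * (norm dl * (L * norm dl)) + L * norm dl"
  have w: "norm (dw dl t) \<le> L * norm dl" if t: "t > 0" for t
  proof -
    have "norm (dw dl t) = inverse t * norm (u (l0 + t *\<^sub>R dl) - u l0)" using t by (simp add: dw_def)
    also have "\<dots> \<le> inverse t * (L * (t * norm dl))"
      using L(2)[OF VI VI, of "l0 + t *\<^sub>R dl" l0] t by (intro mult_left_mono) auto
    also have "\<dots> = L * norm dl" using t by simp
    finally show ?thesis .
  qed
  have b: "- L2_inner M Xi0 (DQ dl t) \<le> t / 2 * c" if t: "t > 0" for t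
  proof -
    have "- L2_inner M Xi0 (DQ dl t) \<le> t / 2 * (2 * (A (DQ dl t) (\<lambda>x. 0) - A (DQ dl t) (DQ dl t)) + 0
     + 2 * (blinfun_apply (B (\<lambda>x. 0)) (dw dl t) - blinfun_apply dl (dw dl t)))"
      by (rule DQ_energy_ineq(2)[OF t L2_zero])
         (use solves_VI_K[OF VI] in \<open>auto simp: L2_inner_def\<close>)
    also have "\<dots> \<le> t / 2 * c"
    proof (rule mult_left_mono)
      have "- blinfun_apply dl (dw dl t) \<le> norm dl * norm (dw dl t)"
        using norm_blinfun[of dl "dw dl t"] by simp
      also have "\<dots> \<le> norm dl * (L * norm dl)" by (intro mult_left_mono w t) simp
      finally show "2 * (A (DQ dl t) (\<lambda>x. 0) - A (DQ dl t) (DQ dl t)) + 0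
          + 2 * (blinfun_apply (B (\<lambda>x. 0)) (dw dl t) - blinfun_apply dl (dw dl t)) \<le> c"
        using A_nonneg[OF DQ_L2, of dl t] mult_nonneg_nonneg[OF less_imp_le[OF L(1)] norm_ge_zero[of dl]]
        unfolding c_def A_zero_right[OF DQ_L2] B_zero blinfun.zero_left by argo
    qed (use t in simp)
    finally show ?thesis .
  qed
  have "0 \<le> c" using L(1) by (simp add: c_def)
  moreover have "norm (dw dl t) \<le> c" if "t > 0" for t
  proof -
    have "0 \<le> norm dl * (L * norm dl)" using L(1) by simp
    with w[OF that] show ?thesis unfolding c_def by argo
  qed
  ultimately show ?thesis
    using feasible_cone_bounds[OF _ DQ_L2 DQ_feasible b] by blast
qed

subsection \<open>Directional differentiability\<close>

definition G :: "('w \<Rightarrow> 'b) \<Rightarrow> real" where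
  "G T = A T T + q T"

lemma G_nonneg: "T \<in> L2 M \<Longrightarrow> 0 \<le> G T"
  by (simp add: G_def A_nonneg q_nonneg)

text \<open>The parallelogram identity for \<open>G\<close>, with the weights written as in
  \<open>relaxed_cone_convex\<close>. By coercivity its last term measures the distance between the
  two points.\<close>

lemma G_midpoint:
  assumes "S \<in> Wt" "T \<in> Wt"
  shows "G (\<lambda>x. (1 - 1/2) *\<^sub>R S x + (1/2) *\<^sub>R T x) = G S / 2 + G T / 2 - G (\<lambda>x. S x - T x) / 4"
proof -
  have L: "S \<in> L2 M" "T \<in> L2 M" using assms by (auto dest: Wt_L2)
  have "A (\<lambda>x. (1/2) *\<^sub>R S x + (1/2) *\<^sub>R T x) (\<lambda>x. (1/2) *\<^sub>R S x + (1/2) *\<^sub>R T x)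
      = A S S / 4 + A S T / 2 + A T T / 4"
    using L by (simp add: A_add_left A_add_right A_scaleR_left A_scaleR_right L2_scaleR L2_add A_commute[OF L(2) L(1)])
  moreover have "q (\<lambda>x. (1/2) *\<^sub>R S x + (1/2) *\<^sub>R T x) = q S / 4 + p S T / 2 + q T / 4"
    using assms
    by (simp add: q_add Wt_scaleR q_scaleR p_scaleR_right p_commute[of "\<lambda>x. (1/2) *\<^sub>R S x"] p_commute[of T S]
        power2_eq_square)
  moreover have "A (\<lambda>x. S x - T x) (\<lambda>x. S x - T x) = A S S - 2 * A S T + A T T"
    using L by (simp add: A_diff_left A_diff_right L2_diff A_commute[OF L(2) L(1)])
  moreover have "q (\<lambda>x. S x - T x) = q S - 2 * p S T + q T"
    using assms by (simp add: q_eq_p p_diff_left p_diff_right Wt_diff p_commute[of T S])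
  ultimately show ?thesis by (simp add: G_def field_simps)
qed

text \<open>
  The difference quotients are almost minimisers of the strictly convex energy \<open>G\<close> over the
  relaxed cones.  Almost minimisers of a uniformly convex energy over nested convex sets converge,
  which bypasses weak compactness.
\<close>

lemma DQ_converges:
  "\<exists>X\<in>L2 M. ((\<lambda>t. L2_norm M (\<lambda>x. DQ dl t x - X x)) \<longlongrightarrow> 0) (at_right 0)"
proof -
  obtain a where a: "a > 0" "\<And>f. f \<in> L2 M \<Longrightarrow> A f f \<ge> a * (L2_norm M f)\<^sup>2"
    using A_coercive unfolding L2_coercive_def by blast
  obtain c where c: "0 \<le> c" "\<And>t. t > 0 \<Longrightarrow> DQ dl t \<in> relaxed_cone (t / 2 * c)"
    "\<And>t. t > 0 \<Longrightarrow> norm (dw dl t) \<le> c"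
    using DQ_bounds by blast
  \<comment> \<open>An element of \<open>H_set M D\<close> lies in every relaxed cone, so no
    constraint set below is empty and \<open>G h0\<close> bounds all the infima.\<close>
  obtain h0 where h0: "h0 \<in> H_set M D" "B h0 = dl"
    using B_surj by (metis UNIV_I image_iff)
  define F where "F e = {T \<in> relaxed_cone e. B T = dl}" for e
  define ep where "ep n = inverse (real (Suc n))" for n
  define gam where "gam n = Inf (G ` F (ep n))" for n
  have ep_pos: "0 < ep n" for n by (simp add: ep_def)
  have ep_mono: "ep n \<le> ep m" if "m \<le> n" for m n using that by (simp add: ep_def)
  have ep_lim: "ep \<longlonglongrightarrow> 0" unfolding ep_def by (rule LIMSEQ_inverse_real_of_nat)
  have F_mono: "F e \<subseteq> F e'" if "e \<le> e'" for e e'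
    using relaxed_cone_mono[OF that] by (auto simp: F_def)
  have F_L2: "T \<in> L2 M" and F_Wt: "T \<in> Wt" if "T \<in> F e" for T e
    using that relaxed_cone_L2 relaxed_cone_Wt by (auto simp: F_def)
  have h0F: "h0 \<in> F (ep n)" for n
    using relaxed_cone_mono[OF less_imp_le[OF ep_pos]] H_set_cone(1)[OF h0(1)] h0(2) by (auto simp: F_def)
  have bdd: "bdd_below (G ` F e)" for e
    by (rule bdd_belowI[of _ 0]) (use F_L2 G_nonneg in auto)
  have gam_le: "gam n \<le> G T" if "T \<in> F (ep n)" for n T
    unfolding gam_def using that bdd by (intro cInf_lower) auto
  have gam_mono: "incseq gam"
    unfolding gam_def incseq_def
    using h0F bdd by (intro allI impI cInf_superset_mono image_mono F_mono ep_mono) auto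
  have gam_bdd: "bdd_above (range gam)"
    by (rule bdd_aboveI[of _ "G h0"]) (use gam_le h0F in auto)
  define gs where "gs = (SUP n. gam n)"
  have gam_lim: "gam \<longlonglongrightarrow> gs"
    unfolding gs_def by (rule LIMSEQ_incseq_SUP[OF gam_bdd gam_mono])
  have gam_gs: "gam n \<le> gs" for n
    unfolding gs_def using gam_bdd by (intro cSUP_upper) auto
  \<comment> \<open>The midpoint is again admissible, so its energy is at least
    \<open>gam n\<close>; the parallelogram identity converts this into a bound on the
    distance.\<close>
  have key: "a / 4 * (L2_norm M (\<lambda>x. S x - T x))\<^sup>2 \<le> G S / 2 + G T / 2 - gam n"
    if "S \<in> F (ep n)" "T \<in> F (ep n)" for S T n
  proof -
    let ?m = "\<lambda>x. (1 - 1/2) *\<^sub>R S x + (1/2) *\<^sub>R T x"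
    have "?m \<in> relaxed_cone (ep n)" using that by (intro relaxed_cone_convex) (auto simp: F_def)
    moreover have "B ?m = dl"
      using that F_L2[OF that(1)] F_L2[OF that(2)]
      by (simp add: B_add B_scaleR L2_scaleR F_def flip: scaleR_add_left)
    ultimately have "gam n \<le> G ?m" by (intro gam_le) (simp add: F_def)
    also have "\<dots> = G S / 2 + G T / 2 - G (\<lambda>x. S x - T x) / 4"
      using that F_Wt by (intro G_midpoint)
    finally have "gam n \<le> G S / 2 + G T / 2 - G (\<lambda>x. S x - T x) / 4" .
    moreover have "a * (L2_norm M (\<lambda>x. S x - T x))\<^sup>2 \<le> G (\<lambda>x. S x - T x)"
      using a(2)[OF L2_diff[OF F_L2[OF that(1)] F_L2[OF that(2)]]] q_nonneg[of "\<lambda>x. S x - T x"]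
      by (simp add: G_def)
    ultimately show ?thesis by simp
  qed
  have "\<exists>T\<in>F (ep n). G T < gam n + ep n" for n
  proof -
    have "Inf (G ` F (ep n)) < gam n + ep n" using ep_pos by (simp add: gam_def)
    then show ?thesis using cInf_lessD[of "G ` F (ep n)"] h0F[of n] by blast
  qed
  \<comment> \<open>Near-minimisers suffice: they are Cauchy by \<open>key\<close>, since the
    increasing infima converge, and no infimum has to be attained.\<close>
  then obtain Y where Y: "\<And>n. Y n \<in> F (ep n)" "\<And>n. G (Y n) < gam n + ep n" by metis
  have YL2: "Y n \<in> L2 M" for n using Y(1) by (rule F_L2)
  have "\<exists>X\<in>L2 M. (\<lambda>n. L2_norm M (\<lambda>x. Y n x - X x)) \<longlonglongrightarrow> 0"
  proof (rule L2_complete[OF YL2])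
    fix e :: real assume e: "e > 0"
    have "(\<lambda>n. gs - gam n + ep n) \<longlonglongrightarrow> gs - gs + 0" by (intro tendsto_intros gam_lim ep_lim)
    moreover have "gs - gs + 0 < a / 4 * e\<^sup>2" using a(1) e by simp
    ultimately have "\<forall>\<^sub>F n in sequentially. gs - gam n + ep n < a / 4 * e\<^sup>2" by (rule order_tendstoD(2))
    then obtain N where N: "gs - gam N + ep N < a / 4 * e\<^sup>2"
      by (auto simp: eventually_sequentially)
    have "L2_norm M (\<lambda>x. Y m x - Y n x) < e" if "m \<ge> N" "n \<ge> N" for m n
    proof -
      have "Y m \<in> F (ep N)" "Y n \<in> F (ep N)"
        using Y(1) F_mono ep_mono that by blast+
      then have "a / 4 * (L2_norm M (\<lambda>x. Y m x - Y n x))\<^sup>2 \<le> G (Y m) / 2 + G (Y n) / 2 - gam N"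
        by (rule key)
      also have "\<dots> \<le> gs - gam N + ep N"
        using Y(2)[of m] Y(2)[of n] gam_gs[of m] gam_gs[of n] ep_mono[OF that(1)] ep_mono[OF that(2)] by simp
      also have "\<dots> < a / 4 * e\<^sup>2" by (rule N)
      finally have "(L2_norm M (\<lambda>x. Y m x - Y n x))\<^sup>2 < e\<^sup>2" using a(1) by simp
      then show ?thesis using e by (simp add: power2_less_imp_less)
    qed
    then show "\<exists>N. \<forall>m\<ge>N. \<forall>n\<ge>N. L2_norm M (\<lambda>x. Y m x - Y n x) < e" by blast
  qed
  then obtain X where XL2: "X \<in> L2 M" and Xlim: "(\<lambda>n. L2_norm M (\<lambda>x. Y n x - X x)) \<longlonglongrightarrow> 0" by blast
  have Yw: "L2_weakly_tendsto M Y X" by (rule L2_strong_imp_weakly_tendsto[OF YL2 XL2 Xlim])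
  have BX: "B X = dl"
  proof (rule LIMSEQ_unique)
    show "(\<lambda>n. B (Y n)) \<longlonglongrightarrow> B X"
      by (rule L2_bounded_linear_tendsto[OF B_bounded_linear YL2 XL2 Xlim])
    show "(\<lambda>n. B (Y n)) \<longlonglongrightarrow> dl" using Y(1) by (simp add: F_def)
  qed
  have XA: "(\<lambda>n. gs + ep n - A (Y n) (Y n)) \<longlonglongrightarrow> gs + 0 - A X X"
    by (intro tendsto_intros ep_lim A_tendsto YL2 XL2 Xlim)
  \<comment> \<open>\<open>relaxed_cone_weakly_closed\<close> asks for one curvature bound along the
    whole sequence. Dropping finitely many terms provides one within \<open>e\<close> of the
    limiting value; \<open>e\<close> is then arbitrary.\<close>
  have Xq: "X \<in> relaxed_cone 0 \<and> q X \<le> gs - A X X + e" if e: "e > 0" for e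
  proof -
    have "\<forall>\<^sub>F n in sequentially. gs + ep n - A (Y n) (Y n) < gs - A X X + e"
      by (rule order_tendstoD(2)[OF XA]) (use e in simp)
    then obtain N where N: "\<And>n. n \<ge> N \<Longrightarrow> gs + ep n - A (Y n) (Y n) < gs - A X X + e"
      by (auto simp: eventually_sequentially)
    have w: "L2_weakly_tendsto M (\<lambda>n. Y (n + N)) X"
      by (rule L2_strong_imp_weakly_tendsto[OF YL2 XL2 LIMSEQ_ignore_initial_segment[OF Xlim]])
    have cn: "Y (n + N) \<in> relaxed_cone (ep (n + N))" for n using Y(1) by (simp add: F_def)
    have qn: "q (Y (n + N)) \<le> gs - A X X + e" for n
      using N[of "n + N"] Y(2)[of "n + N"] gam_gs[of "n + N"] by (simp add: G_def)
    show ?thesis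
      using relaxed_cone_weakly_closed[OF w cn LIMSEQ_ignore_initial_segment[OF ep_lim] qn] by simp
  qed
  then have Xc: "X \<in> relaxed_cone 0" using zero_less_one by blast
  have "q X \<le> gs - A X X" by (rule field_le_epsilon) (use Xq in blast)
  then have GX: "G X \<le> gs" by (simp add: G_def)
  have XF: "X \<in> F (ep n)" for n
    using relaxed_cone_mono[OF less_imp_le[OF ep_pos] Xc] BX by (simp add: F_def)
  obtain Rt where Rt: "\<And>t. Rt t \<in> L2 M" "\<And>t. t > 0 \<Longrightarrow> (\<lambda>x. S0 x + t *\<^sub>R Rt t x) \<in> K_set M D"
    "\<And>t. t > 0 \<Longrightarrow> - L2_inner M Xi0 (Rt t) \<le> t / 2 * q X"
    "((\<lambda>t. L2_norm M (\<lambda>x. Rt t x - X x)) \<longlongrightarrow> 0) (at_right 0)"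
    using recovery_family[OF Xc] by blast
  \<comment> \<open>The energy bound obtained for the quotient from the recovery family of
    \<open>X\<close>. That family need not preserve the image under \<open>B\<close>; the last term
    pays for this and tends to zero.\<close>
  define bet where "bet t = A (Rt t) (Rt t) + q X + 2 * (norm (B (Rt t) - B X) * c)" for t
  have "(bet \<longlongrightarrow> A X X + q X + 2 * (norm (B X - B X) * c)) (at_right 0)"
    unfolding bet_def
    by (intro tendsto_intros A_tendsto L2_bounded_linear_tendsto[OF B_bounded_linear] Rt XL2)
  then have bet_lim: "(bet \<longlongrightarrow> G X) (at_right 0)" by (simp add: G_def)
  have GT: "G (DQ dl t) \<le> bet t" if t: "t > 0" for t
  proof -
    let ?T = "DQ dl t"
    have "q ?T \<le> 2 * (A ?T (Rt t) - A ?T ?T) + q X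
        + 2 * (blinfun_apply (B (Rt t)) (dw dl t) - blinfun_apply dl (dw dl t))"
      by (rule DQ_energy_ineq(1)[OF t Rt(1) Rt(2)[OF t] Rt(3)[OF t]])
    moreover have "2 * A ?T (Rt t) \<le> A ?T ?T + A (Rt t) (Rt t)"
      using A_nonneg[OF L2_diff[OF DQ_L2[of dl t] Rt(1)[of t]]] Rt(1)[of t]
      by (simp add: A_diff_left A_diff_right L2_diff A_commute[OF Rt(1) DQ_L2])
    moreover have "blinfun_apply (B (Rt t)) (dw dl t) - blinfun_apply dl (dw dl t) \<le> norm (B (Rt t) - B X) * c"
    proof -
      have "blinfun_apply (B (Rt t) - B X) (dw dl t) \<le> norm (B (Rt t) - B X) * norm (dw dl t)"
        using norm_blinfun[of "B (Rt t) - B X" "dw dl t"] by simp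
      also have "\<dots> \<le> norm (B (Rt t) - B X) * c" by (intro mult_left_mono c(3) t) simp
      finally show ?thesis by (simp add: BX blinfun.diff_left)
    qed
    ultimately show ?thesis unfolding G_def bet_def by argo
  qed
  have "((\<lambda>t. L2_norm M (\<lambda>x. DQ dl t x - X x)) \<longlongrightarrow> 0) (at_right 0)"
  proof (rule tendstoI)
    fix e :: real assume e: "e > 0"
    \<comment> \<open>The value that \<open>key\<close> assigns to the distance \<open>e\<close>:
      half is spent on the gap between \<open>gam n\<close> and \<open>gs\<close>, half on the gap
      between \<open>bet t\<close> and \<open>G X\<close>.\<close>
    define de where "de = a / 4 * e\<^sup>2"
    have de: "de > 0" using a(1) e by (simp add: de_def)
    have "\<forall>\<^sub>F n in sequentially. gs - de / 2 < gam n"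
      by (rule order_tendstoD(1)[OF gam_lim]) (use de in simp)
    then obtain n where n: "gs - de / 2 < gam n" by (auto simp: eventually_sequentially)
    have ev1: "\<forall>\<^sub>F t in at_right 0. bet t < G X + de"
      by (rule order_tendstoD(2)[OF bet_lim]) (use de in simp)
    have "((\<lambda>t. t / 2 * c) \<longlongrightarrow> 0 / 2 * c) (at_right 0)"
      by (intro tendsto_intros) simp
    then have ev2: "\<forall>\<^sub>F t in at_right 0. t / 2 * c < ep n"
      by (rule order_tendstoD(2)) (simp add: ep_pos)
    have ev3: "\<forall>\<^sub>F t in at_right (0::real). t > 0" by (rule eventually_at_right_less)
    show "\<forall>\<^sub>F t in at_right 0. dist (L2_norm M (\<lambda>x. DQ dl t x - X x)) 0 < e"
      using ev1 ev2 ev3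
    proof eventually_elim
      case (elim t)
      have "DQ dl t \<in> F (ep n)"
        using relaxed_cone_mono[OF less_imp_le[OF elim(2)] c(2)[OF elim(3)]] B_DQ[OF elim(3)] by (simp add: F_def)
      from key[OF this XF]
      have "a / 4 * (L2_norm M (\<lambda>x. DQ dl t x - X x))\<^sup>2 \<le> G (DQ dl t) / 2 + G X / 2 - gam n" .
      also have "\<dots> < a / 4 * e\<^sup>2"
        using GT[OF elim(3)] elim(1) n GX unfolding de_def by linarith
      finally have "(L2_norm M (\<lambda>x. DQ dl t x - X x))\<^sup>2 < e\<^sup>2" using a(1) by simp
      then show ?case using e by (simp add: power2_less_imp_less)
    qed
  qed
  with XL2 show ?thesis by blast
qed

text \<open>The equations on \<open>H_set M D\<close> make the multiplier quotients depend Lipschitz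
  continuously on the difference quotients. A sequence of step sizes gives the candidate limit by
  completeness, and the estimate then covers all step sizes.\<close>

lemma dw_converges:
  assumes XL2: "X \<in> L2 M" and lim: "((\<lambda>t. L2_norm M (\<lambda>x. DQ dl t x - X x)) \<longlongrightarrow> 0) (at_right 0)"
  shows "\<exists>w. (dw dl \<longlongrightarrow> w) (at_right 0)"
proof -
  obtain C where C: "C > 0"
    "\<And>S\<^sub>1 S\<^sub>2 u\<^sub>1 u\<^sub>2. S\<^sub>1 \<in> L2 M \<Longrightarrow> S\<^sub>2 \<in> L2 M \<Longrightarrow> \<forall>h\<in>H_set M D. A S\<^sub>1 h = - blinfun_apply (B h) u\<^sub>1 \<Longrightarrow>
      \<forall>h\<in>H_set M D. A S\<^sub>2 h = - blinfun_apply (B h) u\<^sub>2 \<Longrightarrow>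
      norm (u\<^sub>1 - u\<^sub>2) \<le> C * L2_norm M (\<lambda>x. S\<^sub>1 x - S\<^sub>2 x)"
    using multiplier_Lipschitz by blast
  define t where "t n = inverse (real (Suc n))" for n
  have t: "t n > 0" for n by (simp add: t_def)
  have t_at: "filterlim t (at_right 0) sequentially"
    unfolding t_def using LIMSEQ_inverse_real_of_nat
    by (intro tendsto_imp_filterlim_at_right) auto
  note tlim = filterlim_compose[OF lim t_at]
  have "Cauchy (\<lambda>n. dw dl (t n))"
  proof (rule metric_CauchyI)
    fix e :: real assume e: "e > 0"
    have "\<forall>\<^sub>F n in sequentially. L2_norm M (\<lambda>x. DQ dl (t n) x - X x) < e / (2 * C)"
      by (rule order_tendstoD(2)[OF tlim]) (use e C(1) in simp)
    then obtain N where N: "\<And>n. n \<ge> N \<Longrightarrow> L2_norm M (\<lambda>x. DQ dl (t n) x - X x) < e / (2 * C)"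
      by (auto simp: eventually_sequentially)
    have "dist (dw dl (t m)) (dw dl (t n)) < e" if "m \<ge> N" "n \<ge> N" for m n
    proof -
      have "norm (dw dl (t m) - dw dl (t n)) \<le> C * L2_norm M (\<lambda>x. DQ dl (t m) x - DQ dl (t n) x)"
        using DQ_H[OF t] by (intro C(2)) auto
      also have "\<dots> \<le> C * (L2_norm M (\<lambda>x. DQ dl (t m) x - X x) + L2_norm M (\<lambda>x. DQ dl (t n) x - X x))"
        using C(1) L2_norm_triangle_diff[of "DQ dl (t m)" M "DQ dl (t n)" X] XL2
          L2_norm_minus_commute[of M X "DQ dl (t n)"]
        by (intro mult_left_mono) auto
      also have "\<dots> < C * (e / (2 * C) + e / (2 * C))"
        using N[OF that(1)] N[OF that(2)] C(1) by (intro mult_strict_left_mono add_strict_mono)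
      also have "\<dots> = e" using C(1) by (simp add: field_simps)
      finally show ?thesis by (simp add: dist_norm)
    qed
    then show "\<exists>N. \<forall>m\<ge>N. \<forall>n\<ge>N. dist (dw dl (t m)) (dw dl (t n)) < e" by blast
  qed
  then obtain w where w: "(\<lambda>n. dw dl (t n)) \<longlonglongrightarrow> w"
    using Cauchy_convergent convergent_def by blast
  \<comment> \<open>The limit pair satisfies the same equation, so \<open>dw dl s\<close> can be
    compared with \<open>w\<close> for every \<open>s > 0\<close> and not only along the
    sequence.\<close>
  have Xw: "A X h = - blinfun_apply (B h) w" if h: "h \<in> H_set M D" for h
  proof (rule LIMSEQ_unique)
    show "(\<lambda>n. A (DQ dl (t n)) h) \<longlonglongrightarrow> A X h"
      by (rule A_tendsto[OF _ _ XL2 H_set_L2[OF h] tlim])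
         (auto simp: H_set_L2[OF h] L2_norm_def L2_inner_def)
    have "(\<lambda>n. - blinfun_apply (B h) (dw dl (t n))) \<longlonglongrightarrow> - blinfun_apply (B h) w"
      by (intro tendsto_minus blinfun.tendsto tendsto_const w)
    then show "(\<lambda>n. A (DQ dl (t n)) h) \<longlonglongrightarrow> - blinfun_apply (B h) w"
      by (simp add: DQ_H[OF t h])
  qed
  have "((\<lambda>s. dw dl s - w) \<longlongrightarrow> 0) (at_right 0)"
  proof (rule Lim_null_comparison)
    show "((\<lambda>s. C * L2_norm M (\<lambda>x. DQ dl s x - X x)) \<longlongrightarrow> 0) (at_right 0)"
      using tendsto_mult_left[OF lim, of C] by simp
    show "\<forall>\<^sub>F s in at_right 0. norm (dw dl s - w) \<le> C * L2_norm M (\<lambda>x. DQ dl s x - X x)"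
      using eventually_at_right_less[of "0::real"]
    proof eventually_elim
      case (elim s)
      show ?case using DQ_H[OF elim] Xw by (intro C(2) XL2) auto
    qed
  qed
  then show ?thesis by (auto simp: LIM_zero_iff)
qed

text \<open>Lipschitz continuity of the solution map reduces to constant directions.\<close>

lemma hadamard_derivativeI:
  assumes XL2: "X \<in> L2 M" and lim: "((\<lambda>t. L2_norm M (\<lambda>x. DQ dl t x - X x)) \<longlongrightarrow> 0) (at_right 0)"
    and w: "(dw dl \<longlongrightarrow> w) (at_right 0)"
  shows "has_strong_hadamard_derivative M (\<lambda>l. (Sig l, u l)) l0 dl (X, w)"
proof -
  obtain L where L: "L > 0"
    "\<And>l\<^sub>1 l\<^sub>2 S\<^sub>1 S\<^sub>2 u\<^sub>1 u\<^sub>2. solves_VI M A B D l\<^sub>1 (S\<^sub>1, u\<^sub>1) \<Longrightarrow> solves_VI M A B D l\<^sub>2 (S\<^sub>2, u\<^sub>2) \<Longrightarrow>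
       L2_norm M (\<lambda>x. S\<^sub>1 x - S\<^sub>2 x) \<le> L * norm (l\<^sub>1 - l\<^sub>2) \<and> norm (u\<^sub>1 - u\<^sub>2) \<le> L * norm (l\<^sub>1 - l\<^sub>2)"
    using solution_Lipschitz by blast
  have "((\<lambda>t. L2_norm M (\<lambda>x. (Sig (l0 + t *\<^sub>R d t) x - S0 x) /\<^sub>R t - X x)) \<longlongrightarrow> 0) (at_right 0)"
    "((\<lambda>t. (u (l0 + t *\<^sub>R d t) - u l0) /\<^sub>R t) \<longlongrightarrow> w) (at_right 0)"
    if d: "(d \<longlongrightarrow> dl) (at_right 0)" for d :: "real \<Rightarrow> 'v \<Rightarrow>\<^sub>L real"
  proof -
    have d0: "((\<lambda>t. norm (d t - dl)) \<longlongrightarrow> 0) (at_right 0)"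
      using d by (simp add: tendsto_norm_zero_iff LIM_zero_iff)
    \<comment> \<open>The factor \<open>t\<close> in this distance cancels against the division by
      \<open>t\<close>, leaving an error proportional to \<open>norm (d t - dl)\<close>.\<close>
    have scale: "norm (l0 + t *\<^sub>R d t - (l0 + t *\<^sub>R dl)) = t * norm (d t - dl)" if "t > 0" for t
    proof -
      have "l0 + t *\<^sub>R d t - (l0 + t *\<^sub>R dl) = t *\<^sub>R (d t - dl)" by (simp add: algebra_simps)
      then show ?thesis using that by simp
    qed
    show "((\<lambda>t. L2_norm M (\<lambda>x. (Sig (l0 + t *\<^sub>R d t) x - S0 x) /\<^sub>R t - X x)) \<longlongrightarrow> 0) (at_right 0)"
    proof (rule Lim_null_comparison)
      have "((\<lambda>t. L * norm (d t - dl) + L2_norm M (\<lambda>x. DQ dl t x - X x)) \<longlongrightarrow> L * 0 + 0) (at_right 0)"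
        by (intro tendsto_intros d0 lim)
      then show "((\<lambda>t. L * norm (d t - dl) + L2_norm M (\<lambda>x. DQ dl t x - X x)) \<longlongrightarrow> 0) (at_right 0)" by simp
      show "\<forall>\<^sub>F t in at_right 0. norm (L2_norm M (\<lambda>x. (Sig (l0 + t *\<^sub>R d t) x - S0 x) /\<^sub>R t - X x))
          \<le> L * norm (d t - dl) + L2_norm M (\<lambda>x. DQ dl t x - X x)"
        using eventually_at_right_less[of "0::real"]
      proof eventually_elim
        case (elim t)
        let ?S = "Sig (l0 + t *\<^sub>R d t)" and ?S' = "Sig (l0 + t *\<^sub>R dl)"
        let ?q = "\<lambda>x. (?S x - S0 x) /\<^sub>R t"
        have qL2: "?q \<in> L2 M" by (intro L2_scaleR L2_diff Sig_L2)
        have "(\<lambda>x. ?q x - DQ dl t x) = (\<lambda>x. inverse t *\<^sub>R (?S x - ?S' x))"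
          by (simp add: DQ_def fun_eq_iff algebra_simps)
        then have "L2_norm M (\<lambda>x. ?q x - DQ dl t x) = inverse t * L2_norm M (\<lambda>x. ?S x - ?S' x)"
          using elim by (simp only: L2_norm_scaleR) simp
        also have "\<dots> \<le> inverse t * (L * (t * norm (d t - dl)))"
          using L(2)[OF VI VI, of "l0 + t *\<^sub>R d t" "l0 + t *\<^sub>R dl"] scale[OF elim] elim
          by (intro mult_left_mono) auto
        also have "\<dots> = L * norm (d t - dl)" using elim by simp
        finally show ?case
          using L2_norm_triangle_diff[OF qL2 XL2 DQ_L2[of dl t]] by simp
      qed
    qed
    have "((\<lambda>t. (u (l0 + t *\<^sub>R d t) - u l0) /\<^sub>R t - dw dl t) \<longlongrightarrow> 0) (at_right 0)"
    proof (rule Lim_null_comparison)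
      show "((\<lambda>t. L * norm (d t - dl)) \<longlongrightarrow> 0) (at_right 0)"
        using tendsto_mult_left[OF d0, of L] by simp
      show "\<forall>\<^sub>F t in at_right 0. norm ((u (l0 + t *\<^sub>R d t) - u l0) /\<^sub>R t - dw dl t) \<le> L * norm (d t - dl)"
        using eventually_at_right_less[of "0::real"]
      proof eventually_elim
        case (elim t)
        have "(u (l0 + t *\<^sub>R d t) - u l0) /\<^sub>R t - dw dl t
            = inverse t *\<^sub>R (u (l0 + t *\<^sub>R d t) - u (l0 + t *\<^sub>R dl))"
          by (simp add: dw_def algebra_simps)
        then have "norm ((u (l0 + t *\<^sub>R d t) - u l0) /\<^sub>R t - dw dl t)
            = inverse t * norm (u (l0 + t *\<^sub>R d t) - u (l0 + t *\<^sub>R dl))"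
          using elim by simp
        also have "\<dots> \<le> inverse t * (L * (t * norm (d t - dl)))"
          using L(2)[OF VI VI, of "l0 + t *\<^sub>R d t" "l0 + t *\<^sub>R dl"] scale[OF elim] elim
          by (intro mult_left_mono) auto
        also have "\<dots> = L * norm (d t - dl)" using elim by simp
        finally show ?case .
      qed
    qed
    from tendsto_add[OF this w] show "((\<lambda>t. (u (l0 + t *\<^sub>R d t) - u l0) /\<^sub>R t) \<longlongrightarrow> w) (at_right 0)"
      by simp
  qed
  with XL2 show ?thesis by (simp add: has_strong_hadamard_derivative_def)
qed

lemma strongly_hadamard_differentiable_solution:
  "strongly_hadamard_differentiable M (\<lambda>l. (Sig l, u l)) l0"
  unfolding strongly_hadamard_differentiable_def
  using DQ_converges dw_converges hadamard_derivativeI by meson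

subsection \<open>The linearised variational inequality\<close>

text \<open>The constant family of directions shows that any derivative is the limit of the
  quotients \<open>DQ\<close> and \<open>dw\<close>, whichever way it was found. Recovery families
  carry the competitors to the limit, and lower semicontinuity handles the curvature on the
  left.\<close>

lemma derivative_solves_linearized_VI:
  assumes "has_strong_hadamard_derivative M (\<lambda>l. (Sig l, u l)) l0 dl (S', u')"
  shows "solves_linearized_VI M A B D lam0 (relaxed_cone 0) dl (S', u')"
proof -
  have SL2: "S' \<in> L2 M" and lim: "((\<lambda>t. L2_norm M (\<lambda>x. DQ dl t x - S' x)) \<longlongrightarrow> 0) (at_right 0)"
    and wlim: "(dw dl \<longlongrightarrow> u') (at_right 0)"
    using assms tendsto_const[of dl "at_right (0::real)"]
    by (auto simp: has_strong_hadamard_derivative_def DQ_def dw_def[abs_def])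
  obtain c where c: "0 \<le> c" "\<And>t. t > 0 \<Longrightarrow> DQ dl t \<in> relaxed_cone (t / 2 * c)" "\<And>t. t > 0 \<Longrightarrow> q (DQ dl t) \<le> c"
    using DQ_bounds by blast
  define t where "t n = inverse (real (Suc n))" for n
  have t: "t n > 0" for n by (simp add: t_def)
  have t0: "t \<longlonglongrightarrow> 0" unfolding t_def by (rule LIMSEQ_inverse_real_of_nat)
  have t_at: "filterlim t (at_right 0) sequentially"
    using t0 t by (intro tendsto_imp_filterlim_at_right) auto
  note tlim = filterlim_compose[OF lim t_at]
  note twlim = filterlim_compose[OF wlim t_at]
  have te: "(\<lambda>n. t n / 2 * c) \<longlonglongrightarrow> 0" using tendsto_mult_right[OF t0, of "c / 2"] by simp
  \<comment> \<open>Only an eventual bound on the curvatures is passed to the limit; convergence of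
    \<open>q (DQ dl t)\<close> itself is not claimed.\<close>
  have closed: "S' \<in> relaxed_cone 0 \<and> q S' \<le> k" if ev: "\<forall>\<^sub>F n in sequentially. q (DQ dl (t n)) \<le> k" for k
  proof -
    obtain N where N: "\<And>n. n \<ge> N \<Longrightarrow> q (DQ dl (t n)) \<le> k"
      using ev by (auto simp: eventually_sequentially)
    have w: "L2_weakly_tendsto M (\<lambda>n. DQ dl (t (n + N))) S'"
      by (rule L2_strong_imp_weakly_tendsto[OF DQ_L2 SL2 LIMSEQ_ignore_initial_segment[OF tlim]])
    show ?thesis
      using relaxed_cone_weakly_closed[OF w c(2)[OF t] LIMSEQ_ignore_initial_segment[OF te] N] by simp
  qed
  have Sc: "S' \<in> relaxed_cone 0" using closed[of c] c(3)[OF t] by simp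
  have BS: "B S' = dl"
  proof (rule LIMSEQ_unique)
    show "(\<lambda>n. B (DQ dl (t n))) \<longlonglongrightarrow> B S'"
      by (rule L2_bounded_linear_tendsto[OF B_bounded_linear DQ_L2 SL2 tlim])
    show "(\<lambda>n. B (DQ dl (t n))) \<longlonglongrightarrow> dl" by (simp add: B_DQ[OF t])
  qed
  have ineq: "q S' \<le> 2 * (A S' R - A S' S') + q R + 2 * (blinfun_apply (B R) u' - blinfun_apply dl u')"
    if R: "R \<in> relaxed_cone 0" for R
  proof (rule field_le_epsilon)
    fix e :: real assume e: "e > 0"
    obtain Rt where Rt: "\<And>t. Rt t \<in> L2 M" "\<And>t. t > 0 \<Longrightarrow> (\<lambda>x. S0 x + t *\<^sub>R Rt t x) \<in> K_set M D"
      "\<And>t. t > 0 \<Longrightarrow> - L2_inner M Xi0 (Rt t) \<le> t / 2 * q R"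
      "((\<lambda>t. L2_norm M (\<lambda>x. Rt t x - R x)) \<longlongrightarrow> 0) (at_right 0)"
      using recovery_family[OF R] by blast
    note Rlim = filterlim_compose[OF Rt(4) t_at]
    have RL2: "R \<in> L2 M" using R by (rule relaxed_cone_L2)
    let ?k = "\<lambda>n. 2 * (A (DQ dl (t n)) (Rt (t n)) - A (DQ dl (t n)) (DQ dl (t n))) + q R
       + 2 * (blinfun_apply (B (Rt (t n))) (dw dl (t n)) - blinfun_apply dl (dw dl (t n)))"
    let ?l = "2 * (A S' R - A S' S') + q R + 2 * (blinfun_apply (B R) u' - blinfun_apply dl u')"
    have "?k \<longlonglongrightarrow> ?l"
      by (intro tendsto_add tendsto_diff tendsto_mult tendsto_const blinfun.tendsto A_tendsto
          L2_bounded_linear_tendsto[OF B_bounded_linear] DQ_L2 Rt(1) RL2 SL2 tlim twlim Rlim)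
    then have "\<forall>\<^sub>F n in sequentially. ?k n < ?l + e"
      by (rule order_tendstoD(2)) (use e in simp)
    then have "\<forall>\<^sub>F n in sequentially. q (DQ dl (t n)) \<le> ?l + e"
    proof eventually_elim
      case (elim n)
      with DQ_energy_ineq(1)[OF t Rt(1) Rt(2)[OF t] Rt(3)[OF t], of dl n] show ?case by linarith
    qed
    then show "q S' \<le> ?l + e" using closed by blast
  qed
  have SW: "S' \<in> Wt" using Sc by (rule relaxed_cone_Wt)
  have main: "A S' (\<lambda>x. R x - S' x) + p S' (\<lambda>x. R x - S' x) + blinfun_apply (B (\<lambda>x. R x - S' x)) u' \<ge> 0"
    if R: "R \<in> relaxed_cone 0" for R
  proof -
    let ?d = "\<lambda>x. R x - S' x"
    have RW: "R \<in> Wt" and RL2: "R \<in> L2 M" using R by (auto dest: relaxed_cone_Wt relaxed_cone_L2)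
    have dW: "?d \<in> Wt" and dL2: "?d \<in> L2 M" using RW SW RL2 SL2 by (auto intro: Wt_diff)
    let ?e = "A S' ?d + p S' ?d + blinfun_apply (B ?d) u'"
    \<comment> \<open>By convexity the competitor may be moved to \<open>S' + s (R - S')\<close>.
      Then \<open>q S'\<close> cancels, \<open>?e\<close> collects the terms of first order in
      \<open>s\<close>, and division by \<open>2 s\<close> leaves a remainder vanishing with
      \<open>s\<close>.\<close>
    have "- ?e \<le> s / 2 * q ?d" if s: "0 < s" "s \<le> 1" for s
    proof -
      have eq: "(\<lambda>x. (1 - s) *\<^sub>R S' x + s *\<^sub>R R x) = (\<lambda>x. S' x + s *\<^sub>R ?d x)"
        by (simp add: fun_eq_iff algebra_simps)
      have "(\<lambda>x. S' x + s *\<^sub>R ?d x) \<in> relaxed_cone 0"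
        using relaxed_cone_convex[OF Sc R, of s] s by (simp only: eq)
      from ineq[OF this]
      have "q S' \<le> 2 * (s * A S' ?d) + (q S' + 2 * (s * p S' ?d) + s\<^sup>2 * q ?d) + 2 * (s * blinfun_apply (B ?d) u')"
        using SL2 dL2 SW dW
        by (simp add: A_add_right A_scaleR_right B_add B_scaleR L2_scaleR BS blinfun.add_left blinfun.scaleR_left
            q_add q_scaleR p_scaleR_right Wt_scaleR)
      then have "0 \<le> (2 * s) * (?e + s / 2 * q ?d)" by (simp add: power2_eq_square algebra_simps)
      then show ?thesis using s(1) by (simp add: zero_le_mult_iff)
    qed
    moreover have "((\<lambda>s. s / 2 * q ?d) \<longlongrightarrow> 0 / 2 * q ?d) (at_right 0)"
      by (intro tendsto_intros) simp
    moreover have "\<forall>\<^sub>F s in at_right (0::real). 0 < s \<and> s \<le> 1"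
      using eventually_at_right_less[of "0::real"] eventually_at_right_real[of 0 "1::real"]
      by (auto elim: eventually_mono)
    ultimately have "- ?e \<le> 0 / 2 * q ?d"
      by (intro tendsto_lowerbound[where F = "at_right 0"]) (auto elim: eventually_mono)
    then show ?thesis by simp
  qed
  show ?thesis
    unfolding solves_linearized_VI_def
    using Sc main by (simp add: BS B_star_def p_def blinfun.zero_left add_ac)
qed

text \<open>The arguments for the original inequality carry over: the second component is tested by
  a whole space, and the critical cone is invariant under translation by \<open>H_set M D\<close>,
  where the curvature form vanishes.\<close>

lemma linearized_VI_D:
  assumes "solves_linearized_VI M A B D lam0 (relaxed_cone 0) dl (S, w)"
  shows "S \<in> relaxed_cone 0" "B S = dl"
    "\<And>T. T \<in> relaxed_cone 0 \<Longrightarrow> A S (\<lambda>x. T x - S x) + p S (\<lambda>x. T x - S x) + blinfun_apply (B (\<lambda>x. T x - S x)) w \<ge> 0"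
    "\<And>h. h \<in> H_set M D \<Longrightarrow> A S h = - blinfun_apply (B h) w"
proof -
  have raw: "A S (\<lambda>x. T x - S x) + blinfun_apply (B (\<lambda>x. T x - S x)) w + p S (\<lambda>x. T x - S x)
      - blinfun_apply (B S - dl) (v - w) \<ge> 0" if "T \<in> relaxed_cone 0" for T v
    using assms that by (auto simp: solves_linearized_VI_def B_star_def p_def)
  show Sc: "S \<in> relaxed_cone 0" using assms by (simp add: solves_linearized_VI_def)
  have SL2: "S \<in> L2 M" using Sc by (rule relaxed_cone_L2)
  have "blinfun_apply (B S - dl) v \<le> 0" for v
    using raw[OF Sc, of "v + w"] SL2
    by (simp add: A_zero_right B_zero p_def linear_0[OF linear_D])
  from blinfun_nonpos_imp_0[OF this] show "B S = dl" by simp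
  show ineq: "A S (\<lambda>x. T x - S x) + p S (\<lambda>x. T x - S x) + blinfun_apply (B (\<lambda>x. T x - S x)) w \<ge> 0"
    if "T \<in> relaxed_cone 0" for T
    using raw[OF that, of w] by (simp add: blinfun.zero_right)
  have ge: "A S h + blinfun_apply (B h) w \<ge> 0" if h: "h \<in> H_set M D" for h
  proof -
    have "(\<lambda>x. S x + h x) \<in> relaxed_cone 0" using relaxed_cone_add[OF Sc H_set_cone(1)[OF h]] by simp
    from ineq[OF this] show ?thesis using H_set_cone(3)[OF h SL2] by simp
  qed
  show "A S h = - blinfun_apply (B h) w" if h: "h \<in> H_set M D" for h
    using ge[OF h] ge[OF H_set_uminus[OF h]] A_scaleR_right[OF H_set_L2[OF h] SL2, of "-1"]
      B_scaleR[OF H_set_L2[OF h], of "-1"]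
    by (simp add: blinfun.minus_left)
qed

text \<open>Testing each solution with the other removes the multipliers, since both have image
  \<open>dl\<close>, and coercivity identifies the first components up to a null set. The
  multipliers are then identified by the equations on \<open>H_set M D\<close>.\<close>

lemma linearized_VI_unique:
  assumes 1: "solves_linearized_VI M A B D lam0 (relaxed_cone 0) dl (S\<^sub>1, u\<^sub>1)"
    and 2: "solves_linearized_VI M A B D lam0 (relaxed_cone 0) dl (S\<^sub>2, u\<^sub>2)"
  shows "AE x in M. S\<^sub>1 x = S\<^sub>2 x" and "u\<^sub>1 = u\<^sub>2"
proof -
  note d1 = linearized_VI_D[OF 1] and d2 = linearized_VI_D[OF 2]
  let ?d = "\<lambda>x. S\<^sub>1 x - S\<^sub>2 x"
  have W: "S\<^sub>1 \<in> Wt" "S\<^sub>2 \<in> Wt" and L: "S\<^sub>1 \<in> L2 M" "S\<^sub>2 \<in> L2 M"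
    using d1(1) d2(1) by (auto dest: relaxed_cone_Wt relaxed_cone_L2)
  have dL2: "?d \<in> L2 M" using L by auto
  have i1: "A S\<^sub>1 S\<^sub>2 - A S\<^sub>1 S\<^sub>1 + p S\<^sub>1 S\<^sub>2 - p S\<^sub>1 S\<^sub>1 \<ge> 0"
    using d1(3)[OF d2(1)] L W by (simp add: A_diff_right B_diff p_diff_right d1(2) d2(2) blinfun.zero_left)
  have i2: "A S\<^sub>2 S\<^sub>1 - A S\<^sub>2 S\<^sub>2 + p S\<^sub>2 S\<^sub>1 - p S\<^sub>2 S\<^sub>2 \<ge> 0"
    using d2(3)[OF d1(1)] L W by (simp add: A_diff_right B_diff p_diff_right d1(2) d2(2) blinfun.zero_left)
  have "A ?d ?d + q ?d \<le> 0"
    using i1 i2 L W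
    by (simp add: q_eq_p A_diff_left A_diff_right L2_diff p_diff_left p_diff_right Wt_diff)
  then have "A ?d ?d \<le> 0" using q_nonneg[of ?d] by simp
  moreover obtain a where a: "a > 0" "A ?d ?d \<ge> a * (L2_norm M ?d)\<^sup>2"
    using A_coercive dL2 unfolding L2_coercive_def by blast
  ultimately have "a * (L2_norm M ?d)\<^sup>2 \<le> 0" by linarith
  then have 0: "L2_norm M ?d = 0" using a(1) by (simp add: mult_le_0_iff)
  show "AE x in M. S\<^sub>1 x = S\<^sub>2 x" using L2_norm_eq_0_imp_AE[OF dL2 0] by simp
  obtain C where "norm (u\<^sub>1 - u\<^sub>2) \<le> C * L2_norm M ?d"
    using multiplier_Lipschitz d1(4) d2(4) L by meson
  with 0 show "u\<^sub>1 = u\<^sub>2" by simp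
qed

end

theorem theorem5p4:
  fixes M :: "'w measure"
    and A :: "('w \<Rightarrow> real ^ 'm) \<Rightarrow> ('w \<Rightarrow> real ^ 'm) \<Rightarrow> real"
    and B :: "('w \<Rightarrow> real ^ 'm) \<Rightarrow> 'v::{real_inner, complete_space} \<Rightarrow>\<^sub>L real"
    and D :: "real ^ 'm \<Rightarrow> real ^ 'n"
    and Sig :: "('v \<Rightarrow>\<^sub>L real) \<Rightarrow> 'w \<Rightarrow> real ^ 'm"
    and u :: "('v \<Rightarrow>\<^sub>L real) \<Rightarrow> 'v"
    and l0 :: "'v \<Rightarrow>\<^sub>L real"
    and Xi0 :: "'w \<Rightarrow> real ^ 'm"
    and lam0 :: "'w \<Rightarrow> real"
  assumes "sigma_finite_measure M"
    and "L2_dual_operator M A" and "L2_symmetric M A" and "L2_coercive M A"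
    and "L2_bounded_linear M B"
    and "linear D"
    and "B ` H_set M D = UNIV"
    and "\<And>l. solves_VI M A B D l (Sig l, u l)"
    and "Xi0 \<in> L2 M"
    and "\<And>T. T \<in> L2 M \<Longrightarrow> L2_inner M Xi0 T = - A (Sig l0) T - B_star B (u l0) T"
    and "lam0 \<in> L2 M" and "AE x in M. lam0 x \<ge> 0"
    and "AE x in M. norm (D (Sig l0 x)) < 1 \<longrightarrow> lam0 x = 0"
    and "\<And>T. T \<in> L2 M \<Longrightarrow>
           A (Sig l0) T + B_star B (u l0) T
           + L2_inner M (\<lambda>x. lam0 x *\<^sub>R adjoint D (D (Sig l0 x))) T = 0"
  defines "C0 \<equiv> reduced_critical_cone M (indicator_fun (K_set M D)) (Sig l0) Xi0"
  shows "strongly_hadamard_differentiable M (\<lambda>l. (Sig l, u l)) l0 \<and>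
    (\<forall>dl S' u'. has_strong_hadamard_derivative M (\<lambda>l. (Sig l, u l)) l0 dl (S', u') \<longrightarrow>
       S' \<in> C0 \<and>
       solves_linearized_VI M A B D lam0 C0 dl (S', u') \<and>
       (\<forall>S'' u''. solves_linearized_VI M A B D lam0 C0 dl (S'', u'') \<longrightarrow>
          (AE x in M. S'' x = S' x) \<and> u'' = u'))"
proof -
  interpret vi_solution M A B D Sig u l0 Xi0 lam0
    by (intro vi_solution.intro vi_operators.intro vi_solution_axioms.intro) (fact assms)+
  have C0: "C0 = relaxed_cone 0"
    unfolding C0_def by (rule reduced_critical_cone_eq)
  show ?thesis
    unfolding C0
  proof (intro conjI allI impI)
    show "strongly_hadamard_differentiable M (\<lambda>l. (Sig l, u l)) l0"
      by (rule strongly_hadamard_differentiable_solution)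
    fix dl S' u' assume d: "has_strong_hadamard_derivative M (\<lambda>l. (Sig l, u l)) l0 dl (S', u')"
    note sol = derivative_solves_linearized_VI[OF d]
    show "solves_linearized_VI M A B D lam0 (relaxed_cone 0) dl (S', u')" by (rule sol)
    show "S' \<in> relaxed_cone 0" by (rule linearized_VI_D(1)[OF sol])
    fix S'' u'' assume sol': "solves_linearized_VI M A B D lam0 (relaxed_cone 0) dl (S'', u'')"
    show "AE x in M. S'' x = S' x" by (rule linearized_VI_unique(1)[OF sol' sol])
    show "u'' = u'" by (rule linearized_VI_unique(2)[OF sol' sol])
  qed
qed

end
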